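(* Let $d\ge 1$ and $\alpha\in(0,2)$. There exists a constant $c=c(d,\alpha)>0$ such that the following holds. Let $f\in\mathscr{S}(\mathbb{R}^d)$ be real-valued, let $k\in\{1,\ldots,d\}$, and let $g=\partial_k f$. If $\bar x\in\mathbb{R}^d$ is such that $g(\bar x)=\max_{x\in\mathbb{R}^d} g(x)>0$, then $$\Lambda^\alpha g(\bar x)\ \ge\ \frac{g(\bar x)^{1+\alpha}}{c\,\|f\|_{L^\infty}^{\alpha}}.$$
   Context: $\mathscr{S}(\mathbb{R}^d)$ is the Schwartz class. $\Lambda=(-\Delta)^{1/2}$, and $\Lambda^\alpha$ is the Fourier multiplier $(\Lambda^\alpha g)^{\wedge}(\xi)=|\xi|^\alpha\hat g(\xi)$; for $0<\alpha<2$ it equals $\Lambda^\alpha g(x)=c_{d,\alpha}\,\mathrm{P.V.}\int_{\mathbb{R}^d}\frac{g(x)-g(x-y)}{|y|^{d+\alpha}}\,dy$ with a normalizing constant $c_{d,\alpha}>0$. *)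

theory Defs
  imports "HOL-Analysis.Analysis" "HOL-Probability.Essential_Supremum"
begin

definition partial_deriv :: "'n::finite \<Rightarrow> (real ^ 'n \<Rightarrow> real) \<Rightarrow> real ^ 'n \<Rightarrow> real" where
  "partial_deriv k f x = deriv (\<lambda>t. f (x + t *\<^sub>R axis k 1)) 0"

text \<open>A list of coordinates \<open>ks\<close> plays the role of a multi-index, as \<open>foldr partial_deriv ks f\<close> is
  an iterated partial derivative of \<open>f\<close>. Frechet differentiability of all of these is smoothness.\<close>

definition schwartz :: "(real ^ 'n::finite \<Rightarrow> real) \<Rightarrow> bool" where
  "schwartz f \<longleftrightarrow>
     (\<forall>ks x. foldr partial_deriv ks f differentiable (at x)) \<and>
     (\<forall>ks N. \<exists>C. \<forall>x. (1 + norm x) ^ N * \<bar>foldr partial_deriv ks f x\<bar> \<le> C)"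

definition fourier :: "(real ^ 'n::finite \<Rightarrow> complex) \<Rightarrow> real ^ 'n \<Rightarrow> complex" where
  "fourier g \<xi> = (\<integral>x. exp (- \<i> * of_real (x \<bullet> \<xi>)) * g x \<partial>lborel)"

definition inverse_fourier :: "(real ^ 'n::finite \<Rightarrow> complex) \<Rightarrow> real ^ 'n \<Rightarrow> complex" where
  "inverse_fourier h x =
     of_real (1 / (2 * pi) ^ CARD('n)) * (\<integral>\<xi>. exp (\<i> * of_real (x \<bullet> \<xi>)) * h \<xi> \<partial>lborel)"

definition frac_laplacian_complex ::
    "real \<Rightarrow> (real ^ 'n::finite \<Rightarrow> complex) \<Rightarrow> real ^ 'n \<Rightarrow> complex" where
  "frac_laplacian_complex \<alpha> g =
     inverse_fourier (\<lambda>\<xi>. of_real (norm \<xi> powr \<alpha>) * fourier g \<xi>)"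

text \<open>On real-valued functions the multiplier is real-valued, so taking the real part loses
  nothing; see \<open>of_real_frac_laplacian\<close> below.\<close>

definition frac_laplacian :: "real \<Rightarrow> (real ^ 'n::finite \<Rightarrow> real) \<Rightarrow> real ^ 'n \<Rightarrow> real" where
  "frac_laplacian \<alpha> g x = Re (frac_laplacian_complex \<alpha> (\<lambda>y. of_real (g y)) x)"

text \<open>The library's essential supremum is extended-real-valued; the conversion to \<open>real\<close> is
  meaningful for essentially bounded measurable \<open>f\<close> only.\<close>

definition Linfty_norm :: "(real ^ 'n::finite \<Rightarrow> real) \<Rightarrow> real" where
  "Linfty_norm f = real_of_ereal (esssup lborel (\<lambda>x. ereal \<bar>f x\<bar>))"

lemma lborel_distr_uminus_vec: "distr lborel borel uminus = (lborel :: (real ^ 'n::finite) measure)"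
  using lborel_affine[of "-1" "0 :: real ^ 'n"]
  by (simp add: density_1 one_ennreal_def[symmetric])

lemma lborel_integral_uminus:
  fixes h :: "real ^ 'n::finite \<Rightarrow> complex"
  shows "(\<integral>x. h (- x) \<partial>lborel) = (\<integral>x. h x \<partial>lborel)"
proof (cases "h \<in> borel_measurable borel")
  case True
  then have "(\<integral>x. h x \<partial>distr lborel borel uminus) = (\<integral>x. h (- x) \<partial>lborel)"
    by (intro integral_distr) auto
  then show ?thesis
    by (simp add: lborel_distr_uminus_vec)
next
  case False
  have "(\<lambda>x. h (- x)) \<notin> borel_measurable borel"
  proof
    assume "(\<lambda>x. h (- x)) \<in> borel_measurable borel"
    then have "(\<lambda>x. h (- (- x))) \<in> borel_measurable borel"
      by (rule measurable_compose[rotated]) measurable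
    with False show False by simp
  qed
  with False have "\<not> integrable lborel h" "\<not> integrable lborel (\<lambda>x. h (- x))"
    by (auto dest!: borel_measurable_integrable)
  then show ?thesis
    by (simp add: not_integrable_integral_eq)
qed

lemma cnj_fourier_of_real: "cnj (fourier (\<lambda>y. of_real (g y)) \<xi>) = fourier (\<lambda>y. of_real (g y)) (- \<xi>)"
  unfolding fourier_def by (subst Bochner_Integration.integral_cnj[symmetric]) (simp add: exp_cnj)

lemma of_real_frac_laplacian:
  "complex_of_real (frac_laplacian \<alpha> g x) = frac_laplacian_complex \<alpha> (\<lambda>y. of_real (g y)) x"
proof -
  define F where "F \<xi> = exp (\<i> * of_real (x \<bullet> \<xi>)) *
    (of_real (norm \<xi> powr \<alpha>) * fourier (\<lambda>y. of_real (g y)) \<xi>)" for \<xi>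
  have "cnj (F \<xi>) = F (- \<xi>)" for \<xi>
    unfolding F_def by (simp add: cnj_fourier_of_real exp_cnj)
  then have "cnj (\<integral>\<xi>. F \<xi> \<partial>lborel) = (\<integral>\<xi>. F \<xi> \<partial>lborel)"
    by (subst Bochner_Integration.integral_cnj[symmetric]) (simp add: lborel_integral_uminus)
  then have "cnj (frac_laplacian_complex \<alpha> (\<lambda>y. of_real (g y)) x)
      = frac_laplacian_complex \<alpha> (\<lambda>y. of_real (g y)) x"
    by (simp add: frac_laplacian_complex_def inverse_fourier_def F_def)
  then show ?thesis
    by (simp add: frac_laplacian_def complex_eq_iff)
qed

end

theory Submission
  imports Defs "HOL-Probability.Characteristic_Functions" "HOL-Probability.Sinc_Integral"
begin

text \<open>
  Write \<open>P\<^sub>\<sigma> h\<close> for the convolution of \<open>h\<close> with the centred Gaussian density whose coordinates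
  are independent of standard deviation \<open>\<sigma>\<close>; this is the heat semigroup at time \<open>\<sigma>\<^sup>2 / 2\<close>, with
  Fourier multiplier \<open>exp (- \<sigma>\<^sup>2 \<bar>\<xi>\<bar>\<^sup>2 / 2)\<close>. Scaling gives, for \<open>0 < \<alpha> < 2\<close>,
  \<open>K \<bar>\<xi>\<bar>\<^sup>\<alpha> = \<integral> (1 - exp (- \<sigma>\<^sup>2 \<bar>\<xi>\<bar>\<^sup>2 / 2)) \<sigma> powr (- 1 - \<alpha>) d\<sigma>\<close> over \<open>\<sigma> > 0\<close>, with a finite constant
  \<open>K > 0\<close>. By Fubini and Fourier inversion,
  \<open>K \<Lambda>\<^sup>\<alpha> g(x) = \<integral> (g(x) - P\<^sub>\<sigma> g(x)) \<sigma> powr (- 1 - \<alpha>) d\<sigma>\<close>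
  for every Schwartz function \<open>g\<close> (lemma \<open>frac_laplacian_heat\<close>). This takes the place of the
  singular integral: no principal value is needed and the integrand is nonnegative at a maximum of
  \<open>g\<close>, because \<open>P\<^sub>\<sigma>\<close> averages.

  If \<open>g = \<partial>\<^sub>k f\<close>, an integration by parts moves the derivative to the Gaussian, whose derivative has
  \<open>L\<^sup>1\<close> norm at most \<open>1 / \<sigma>\<close>; hence \<open>\<bar>P\<^sub>\<sigma> g\<bar> \<le> \<parallel>f\<parallel>\<^sub>\<infinity> / \<sigma>\<close> (lemma \<open>heat_partial_deriv_le\<close>). So for
  \<open>\<sigma> \<ge> S = 2 \<parallel>f\<parallel>\<^sub>\<infinity> / g(x)\<close> the integrand is at least \<open>g(x) / 2\<close> times \<open>\<sigma> powr (- 1 - \<alpha>)\<close>, and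
  integrating over \<open>\<sigma> \<ge> S\<close> alone gives \<open>K \<Lambda>\<^sup>\<alpha> g(x) \<ge> g(x) S powr (- \<alpha>) / (2 \<alpha>)\<close>, which is the
  claim with \<open>c = 2 \<alpha> K 2\<^sup>\<alpha>\<close>.

  Inversion requires integrability of the Fourier transform, and Fubini also that of its product with
  \<open>\<bar>\<xi>\<bar>\<^sup>\<alpha>\<close>. Both follow from
  the rule that differentiation becomes multiplication by \<open>\<i> \<xi>\<^sub>k\<close>, which rests, like the bound on
  \<open>P\<^sub>\<sigma> \<partial>\<^sub>k f\<close>, on the vanishing of the integral of a partial derivative
  (lemma \<open>integral_partial_deriv_zero\<close>).
\<close>

section \<open>Integration on Euclidean space\<close>

text \<open>The standard basis vectors are the index set of the product underlying Lebesgue measure; products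
  over them become products over the coordinates.\<close>

lemma prod_Basis_vec:
  fixes f :: "'n::finite \<Rightarrow> real \<Rightarrow> 'a::comm_monoid_mult"
  shows "(\<Prod>b\<in>Basis. f (axis_index b) ((x :: real ^ 'n) \<bullet> b)) = (\<Prod>i\<in>UNIV. f i (x $ i))"
proof -
  have B: "(Basis :: (real ^ 'n) set) = (\<lambda>i. axis i 1) ` UNIV"
    by (auto simp: Basis_vec_def)
  have "inj (\<lambda>i. axis i 1 :: real ^ 'n)"
    by (auto simp: inj_on_def axis_eq_axis)
  then show ?thesis
    by (simp add: B prod.reindex inner_axis axis_index_axis)
qed

lemma
  fixes f :: "'n::finite \<Rightarrow> real \<Rightarrow> 'a::{real_normed_field,banach,second_countable_topology}"
  assumes f: "\<And>i. integrable lborel (f i)"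
  shows integrable_lborel_vec_prod:
      "integrable lborel (\<lambda>x :: real ^ 'n. \<Prod>i\<in>UNIV. f i (x $ i))"
    and integral_lborel_vec_prod:
      "(\<integral>x. (\<Prod>i\<in>UNIV. f i ((x :: real ^ 'n) $ i)) \<partial>lborel) = (\<Prod>i\<in>UNIV. \<integral>x. f i x \<partial>lborel)"
proof -
  interpret product_sigma_finite "\<lambda>_ :: real ^ 'n. lborel :: real measure"
    by unfold_locales
  have [measurable]: "f i \<in> borel_measurable borel" for i
    using borel_measurable_integrable[OF f[of i]] by simp
  let ?F = "\<lambda>x :: real ^ 'n. \<Prod>i\<in>UNIV. f i (x $ i)"
  let ?P = "Pi\<^sub>M (Basis :: (real ^ 'n) set) (\<lambda>_. lborel :: real measure)"
  let ?T = "\<lambda>g. \<Sum>b\<in>(Basis :: (real ^ 'n) set). g b *\<^sub>R b"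
  have T: "?T \<in> measurable ?P borel"
    by measurable
  have comp: "?F (?T g) = (\<Prod>b\<in>Basis. f (axis_index b) (g b))" for g
    by (subst prod_Basis_vec[symmetric], rule prod.cong) (auto simp: inner_sum_left_Basis)
  have meas: "?F \<in> borel_measurable borel"
    by measurable
  have prodR: "(\<Prod>b\<in>(Basis :: (real ^ 'n) set). \<integral>x. f (axis_index b) x \<partial>lborel)
      = (\<Prod>i\<in>UNIV. \<integral>x. f i x \<partial>lborel)"
    using prod_Basis_vec[of "\<lambda>i _. \<integral>x. f i x \<partial>lborel"] by simp
  show "integrable lborel ?F"
    by (subst lborel_eq, subst integrable_distr_eq[OF T meas])
       (simp only: comp, rule product_integrable_prod, auto intro: f)
  show "(\<integral>x. ?F x \<partial>lborel) = (\<Prod>i\<in>UNIV. \<integral>x. f i x \<partial>lborel)"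
    by (subst lborel_eq, subst integral_distr[OF T meas])
       (simp only: comp, subst product_integral_prod, auto intro: f simp: prodR)
qed

lemma integral_translate:
  fixes h :: "real ^ 'n::finite \<Rightarrow> 'a::{banach,second_countable_topology}"
  assumes [measurable]: "h \<in> borel_measurable borel"
  shows "(\<integral>x. h (x + a) \<partial>lborel) = (\<integral>x. h x \<partial>lborel)"
proof -
  have "(\<integral>x. h x \<partial>lborel) = (\<integral>x. h x \<partial>distr lborel borel ((+) a))"
    by (simp add: lborel_distr_plus)
  also have "\<dots> = (\<integral>x. h (x + a) \<partial>lborel)"
    by (subst integral_distr) (auto simp: add.commute)
  finally show ?thesis by simp
qed

lemma integral_reflect:
  fixes h :: "real ^ 'n::finite \<Rightarrow> 'a::{banach,second_countable_topology}"
  assumes [measurable]: "h \<in> borel_measurable borel"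
  shows "(\<integral>x. h (a - x) \<partial>lborel) = (\<integral>x. h x \<partial>lborel)"
proof -
  have "(\<integral>x. h x \<partial>lborel) = (\<integral>x. h x \<partial>distr lborel borel uminus)"
    by (simp add: lborel_distr_uminus_vec)
  also have "\<dots> = (\<integral>x. h (- x) \<partial>lborel)"
    by (subst integral_distr) auto
  also have "\<dots> = (\<integral>x. h (- (x + - a)) \<partial>lborel)"
    by (rule integral_translate[symmetric]) measurable
  finally show ?thesis by simp
qed

lemma integrable_reflect:
  fixes h :: "real ^ 'n::finite \<Rightarrow> 'a::{banach,second_countable_topology}"
  assumes "integrable lborel h"
  shows "integrable lborel (\<lambda>x. h (a - x))"
proof -
  have [measurable]: "h \<in> borel_measurable borel"
    using borel_measurable_integrable[OF assms] by simp
  have "distr lborel borel (\<lambda>x. a - x) = distr (distr lborel borel uminus) borel ((+) a)"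
    by (subst distr_distr) (auto simp: o_def)
  also have "\<dots> = lborel"
    by (simp add: lborel_distr_uminus_vec lborel_distr_plus)
  finally show ?thesis
    using assms integrable_distr_eq[of "\<lambda>x. a - x" lborel borel h] by simp
qed

lemma AE_lborel_const: "(AE x in (lborel :: 'a::euclidean_space measure). P) \<longleftrightarrow> P"
  by (simp add: eventually_const_iff ae_filter_eq_bot_iff)

section \<open>Polynomial decay and integration by parts\<close>

text \<open>An integrable weight. The exponent is twice the dimension rather than the optimal one because
  the weight is then dominated by a product of the one-dimensional weights \<open>1 / (1 + t\<^sup>2)\<close>.\<close>

definition decay_weight :: "real ^ 'n::finite \<Rightarrow> real" where
  "decay_weight x = 1 / (1 + norm x) ^ (2 * CARD('n))"

lemma decay_weight_pos: "0 < decay_weight x"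
  by (simp add: decay_weight_def add_pos_nonneg)

lemma decay_weight_measurable [measurable]: "decay_weight \<in> borel_measurable borel"
  unfolding decay_weight_def by measurable

text \<open>Shifts by a vector of length at most one, as they occur in difference quotients, cost only a
  constant factor.\<close>

lemma decay_weight_shift:
  fixes x h :: "real ^ 'n::finite"
  assumes "norm h \<le> 1"
  shows "decay_weight (x + h) \<le> 2 ^ (2 * CARD('n)) * decay_weight x"
proof -
  have "norm x \<le> norm (x + h) + norm h"
    by (metis add_diff_cancel_right' norm_triangle_ineq4)
  then have "1 + norm x \<le> 2 * (1 + norm (x + h))"
    using assms norm_ge_zero[of "x + h"] by (smt (verit))
  then have "(1 + norm x) ^ (2 * CARD('n)) \<le> (2 * (1 + norm (x + h))) ^ (2 * CARD('n))"
    by (intro power_mono) auto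
  moreover have "0 < 1 + norm x" "0 < 1 + norm (x + h)"
    by (simp_all add: add_pos_nonneg)
  ultimately show ?thesis
    unfolding decay_weight_def power_mult_distrib by (simp add: field_simps)
qed

lemma integrable_decay_weight: "integrable lborel (decay_weight :: real ^ 'n::finite \<Rightarrow> real)"
proof (rule Bochner_Integration.integrable_bound)
  have "set_integrable lborel (einterval (-\<infinity>) \<infinity>) (\<lambda>x. inverse (1 + x\<^sup>2))"
    by (rule integrable_inverse_1_plus_square)
  then have "integrable lborel (\<lambda>x :: real. inverse (1 + x\<^sup>2))"
    by (simp add: set_integrable_def)
  then show "integrable lborel (\<lambda>x :: real ^ 'n. \<Prod>i\<in>UNIV. inverse (1 + (x $ i)\<^sup>2))"
    by (rule integrable_lborel_vec_prod)
  show "AE x in lborel. norm (decay_weight (x :: real ^ 'n)) \<le> norm (\<Prod>i\<in>UNIV. inverse (1 + (x $ i)\<^sup>2))"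
  proof (rule AE_I2)
    fix x :: "real ^ 'n"
    have "1 + (x $ i)\<^sup>2 \<le> (1 + norm x)\<^sup>2" for i
      using power_mono[OF component_le_norm_cart[of x i], of 2] by (simp add: power2_sum add_increasing2)
    then have "(\<Prod>i\<in>UNIV. 1 + (x $ i)\<^sup>2) \<le> (\<Prod>i\<in>(UNIV :: 'n set). (1 + norm x)\<^sup>2)"
      by (intro prod_mono) auto
    moreover have "0 < (\<Prod>i\<in>UNIV. 1 + (x $ i)\<^sup>2)"
      by (intro prod_pos) (auto simp: add_pos_nonneg)
    ultimately have "decay_weight x \<le> inverse (\<Prod>i\<in>UNIV. 1 + (x $ i)\<^sup>2)"
      by (simp add: decay_weight_def power_mult divide_inverse le_imp_inverse_le)
    then show "norm (decay_weight x) \<le> norm (\<Prod>i\<in>UNIV. inverse (1 + (x $ i)\<^sup>2))"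
      using decay_weight_pos[of x] by (simp add: prod_inversef flip: prod_inversef)
  qed
qed measurable

lemma integrable_if_decay:
  fixes h :: "real ^ 'n::finite \<Rightarrow> 'a::{banach,second_countable_topology}"
  assumes "h \<in> borel_measurable borel" and "\<And>x. norm (h x) \<le> C * decay_weight x"
  shows "integrable lborel h"
proof (rule Bochner_Integration.integrable_bound)
  show "integrable lborel (\<lambda>x :: real ^ 'n. C * decay_weight x)"
    by (rule integrable_mult_right) (rule integrable_decay_weight)
  show "AE x in lborel. norm (h x) \<le> norm (C * decay_weight x)"
    by (auto intro!: AE_I2 order_trans[OF assms(2) abs_ge_self])
qed (use assms in simp)

text \<open>The integrals of the difference quotients of \<open>H\<close> vanish by translation invariance. By the mean
  value inequality the quotients are dominated by a multiple of the weight, so that the limit can be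
  taken under the integral.\<close>

lemma integral_partial_deriv_zero:
  fixes H H' :: "real ^ 'n::finite \<Rightarrow> 'a::{banach,second_countable_topology}"
  assumes der: "\<And>x. ((\<lambda>t. H (x + t *\<^sub>R axis k 1)) has_vector_derivative H' x) (at 0)"
    and H: "integrable lborel H"
    and bound: "\<And>x. norm (H' x) \<le> C * decay_weight x"
  shows "(\<integral>x. H' x \<partial>lborel) = 0"
proof -
  define e :: "real ^ 'n" where "e = axis k 1"
  define t where "t n = inverse (real (Suc n))" for n
  define Q where "Q n x = (1 / t n) *\<^sub>R (H (x + t n *\<^sub>R e) - H x)" for n x
  have t: "0 < t n" "t n \<le> 1" for n
    by (auto simp: t_def inverse_le_1_iff)
  have Hm [measurable]: "H \<in> borel_measurable borel"
    using borel_measurable_integrable[OF H] by simp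
  have C: "0 \<le> C"
    using bound[of 0] decay_weight_pos[of "0 :: real ^ 'n"]
    by (metis norm_ge_zero order_trans zero_le_mult_iff not_less)
  have der': "((\<lambda>t. H (x + t *\<^sub>R e)) has_vector_derivative H' (x + s *\<^sub>R e)) (at s)" for x s
  proof -
    have "((\<lambda>t. H ((x + s *\<^sub>R e) + t *\<^sub>R e)) has_vector_derivative H' (x + s *\<^sub>R e)) (at 0)"
      using der unfolding e_def .
    moreover have "((\<lambda>t. H (x + t *\<^sub>R e)) \<circ> (\<lambda>u. u + s)) = (\<lambda>t. H ((x + s *\<^sub>R e) + t *\<^sub>R e))"
      by (auto simp: fun_eq_iff algebra_simps)
    ultimately have "((\<lambda>t. H (x + t *\<^sub>R e)) \<circ> (\<lambda>u. u + s) has_vector_derivative H' (x + s *\<^sub>R e)) (at (s - s))"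
      by simp
    then have "(((\<lambda>t. H (x + t *\<^sub>R e)) \<circ> (\<lambda>u. u + s)) \<circ> (\<lambda>u. u - s) has_vector_derivative
        1 *\<^sub>R H' (x + s *\<^sub>R e)) (at s)"
      by (intro vector_diff_chain_at) (auto intro!: derivative_eq_intros)
    then show ?thesis by (simp add: o_def)
  qed
  have lim: "(\<lambda>n. Q n x) \<longlonglongrightarrow> H' x" for x
  proof -
    have "((\<lambda>h. (H (x + (0 + h) *\<^sub>R e) - H (x + 0 *\<^sub>R e)) /\<^sub>R h) \<longlongrightarrow> H' x) (at 0)"
    proof -
      have "((\<lambda>h. norm (H (x + (0 + h) *\<^sub>R e) - H (x + 0 *\<^sub>R e) - h *\<^sub>R H' x) / norm h) \<longlongrightarrow> 0) (at 0)"
        using der[of x] unfolding e_def has_vector_derivative_def has_derivative_at by simp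
      then have "((\<lambda>h. norm ((H (x + (0 + h) *\<^sub>R e) - H (x + 0 *\<^sub>R e)) /\<^sub>R h - H' x)) \<longlongrightarrow> 0) (at 0)"
      proof (rule Lim_transform_eventually)
        have "norm (v - h *\<^sub>R w) / norm h = norm (v /\<^sub>R h - w)" if "h \<noteq> 0" for h and v w :: 'a
        proof -
          have "v /\<^sub>R h - w = (v - h *\<^sub>R w) /\<^sub>R h"
            using that by (simp add: scaleR_diff_right)
          then show ?thesis
            by (simp add: divide_inverse)
        qed
        then show "\<forall>\<^sub>F h in at 0. norm (H (x + (0 + h) *\<^sub>R e) - H (x + 0 *\<^sub>R e) - h *\<^sub>R H' x) / norm h
            = norm ((H (x + (0 + h) *\<^sub>R e) - H (x + 0 *\<^sub>R e)) /\<^sub>R h - H' x)"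
          by (auto simp: eventually_at_filter)
      qed
      then show ?thesis
        by (subst Lim_null) (rule tendsto_norm_zero_cancel)
    qed
    moreover have "filterlim t (at 0) sequentially"
      unfolding filterlim_at using LIMSEQ_inverse_real_of_nat t by (auto simp: t_def[abs_def])
    ultimately have "(\<lambda>n. (H (x + (0 + t n) *\<^sub>R e) - H (x + 0 *\<^sub>R e)) /\<^sub>R t n) \<longlonglongrightarrow> H' x"
      by (rule filterlim_compose)
    then show ?thesis by (simp add: Q_def divide_inverse)
  qed
  have Qb: "norm (Q n x) \<le> (C * 2 ^ (2 * CARD('n))) * decay_weight x" for n x
  proof -
    have "norm (H (x + t n *\<^sub>R e) - H (x + 0 *\<^sub>R e))
        \<le> ((C * 2 ^ (2 * CARD('n))) * decay_weight x) * norm (t n - 0)"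
    proof (rule differentiable_bound[where S = "{0..t n}" and f' = "\<lambda>s h. h *\<^sub>R H' (x + s *\<^sub>R e)"])
      fix s assume s: "s \<in> {0..t n}"
      show "((\<lambda>t. H (x + t *\<^sub>R e)) has_derivative (\<lambda>h. h *\<^sub>R H' (x + s *\<^sub>R e))) (at s within {0..t n})"
        using has_vector_derivative_at_within[OF der'] by (simp add: has_vector_derivative_def)
      have "norm (s *\<^sub>R e) \<le> 1"
        using s t(2)[of n] by (simp add: e_def norm_axis_1)
      from decay_weight_shift[OF this, of x] C
      have "C * decay_weight (x + s *\<^sub>R e) \<le> C * (2 ^ (2 * CARD('n)) * decay_weight x)"
        by (rule mult_left_mono)
      then have "norm (H' (x + s *\<^sub>R e)) \<le> (C * 2 ^ (2 * CARD('n))) * decay_weight x"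
        using bound[of "x + s *\<^sub>R e"] by (simp add: mult.assoc)
      then show "onorm (\<lambda>h. h *\<^sub>R H' (x + s *\<^sub>R e)) \<le> (C * 2 ^ (2 * CARD('n))) * decay_weight x"
        by (intro onorm_bound)
           (auto simp: mult.commute[of _ "\<bar>_\<bar>"] intro!: mult_left_mono intro: order_trans[OF norm_ge_zero])
    qed (use t[of n] in auto)
    moreover have "norm (Q n x) = norm (H (x + t n *\<^sub>R e) - H (x + 0 *\<^sub>R e)) / t n"
      using t[of n] by (simp add: Q_def)
    ultimately show ?thesis
      using t[of n] by (simp add: pos_divide_le_eq)
  qed
  have "(\<lambda>n. \<integral>x. Q n x \<partial>lborel) \<longlonglongrightarrow> (\<integral>x. H' x \<partial>lborel)"
  proof (rule integral_dominated_convergence)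
    show Qm: "Q n \<in> borel_measurable lborel" for n
      unfolding Q_def by measurable
    show "H' \<in> borel_measurable lborel"
      by (rule borel_measurable_LIMSEQ_metric[OF Qm lim])
    show "integrable lborel (\<lambda>x :: real ^ 'n. (C * 2 ^ (2 * CARD('n))) * decay_weight x)"
      by (rule integrable_mult_right) (rule integrable_decay_weight)
  qed (use lim Qb in auto)
  moreover have "(\<integral>x. Q n x \<partial>lborel) = 0" for n
  proof -
    have "integrable (distr lborel borel ((+) (t n *\<^sub>R e))) H"
      using H by (simp add: lborel_distr_plus)
    then have "integrable lborel (\<lambda>x. H (x + t n *\<^sub>R e))"
      by (subst (asm) integrable_distr_eq) (auto simp: add.commute)
    then show ?thesis
      unfolding Q_def using H by (simp add: integral_translate)
  qed
  ultimately show ?thesis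
    by (simp add: LIMSEQ_const_iff)
qed

section \<open>Schwartz functions\<close>

lemma schwartz_partial_deriv:
  assumes "schwartz f"
  shows "schwartz (partial_deriv k f)"
proof -
  have "foldr partial_deriv ks (partial_deriv k f) = foldr partial_deriv (ks @ [k]) f" for ks
    by simp
  then show ?thesis
    using assms unfolding schwartz_def by metis
qed

lemma schwartz_differentiable: "schwartz f \<Longrightarrow> f differentiable (at x)"
  unfolding schwartz_def by (metis foldr_Nil id_apply)

lemma schwartz_continuous_on: "schwartz f \<Longrightarrow> continuous_on S f"
  by (meson continuous_at_imp_continuous_on differentiable_imp_continuous_within
      schwartz_differentiable)

lemma schwartz_measurable: "schwartz f \<Longrightarrow> f \<in> borel_measurable borel"
  by (intro borel_measurable_continuous_onI schwartz_continuous_on)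

lemma schwartz_decay:
  assumes "schwartz f"
  shows "\<exists>C. \<forall>x. (1 + norm x) ^ N * \<bar>f x\<bar> \<le> C"
  using assms unfolding schwartz_def by (metis foldr_Nil id_apply)

lemma schwartz_bounded:
  assumes "schwartz f"
  shows "\<exists>C. \<forall>x. \<bar>f x\<bar> \<le> C"
  using schwartz_decay[OF assms, of 0] by simp

text \<open>The factor \<open>1 + norm x\<close> leaves room for a function of linear growth.\<close>

lemma schwartz_norm_mult_le_decay_weight:
  fixes f :: "real ^ 'n::finite \<Rightarrow> real"
  assumes "schwartz f"
  shows "\<exists>C. \<forall>x. (1 + norm x) * \<bar>f x\<bar> \<le> C * decay_weight x"
proof -
  obtain C where C: "\<And>x. (1 + norm x) ^ Suc (2 * CARD('n)) * \<bar>f x\<bar> \<le> C"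
    using schwartz_decay[OF assms] by blast
  have "(1 + norm x) * \<bar>f x\<bar> \<le> C * decay_weight x" for x
  proof -
    have "0 < (1 + norm x) ^ (2 * CARD('n))"
      by (simp add: add_pos_nonneg)
    then show ?thesis
      using C[of x] by (simp add: decay_weight_def field_simps)
  qed
  then show ?thesis by blast
qed

lemma schwartz_le_decay_weight:
  fixes f :: "real ^ 'n::finite \<Rightarrow> real"
  assumes "schwartz f"
  shows "\<exists>C. \<forall>x. \<bar>f x\<bar> \<le> C * decay_weight x"
proof -
  obtain C where C: "\<And>x. (1 + norm x) * \<bar>f x\<bar> \<le> C * decay_weight x"
    using schwartz_norm_mult_le_decay_weight[OF assms] by blast
  have "\<bar>f x\<bar> \<le> (1 + norm x) * \<bar>f x\<bar>" for x
    by (simp add: distrib_right)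
  then show ?thesis
    using C order_trans by blast
qed

lemma schwartz_integrable:
  assumes "schwartz f"
  shows "integrable lborel f"
proof -
  obtain C where "\<And>x. \<bar>f x\<bar> \<le> C * decay_weight x"
    using schwartz_le_decay_weight[OF assms] by blast
  then show ?thesis
    by (intro integrable_if_decay schwartz_measurable[OF assms]) auto
qed

lemma schwartz_has_partial_deriv:
  assumes "schwartz f"
  shows "((\<lambda>t. f (x + t *\<^sub>R axis k 1)) has_real_derivative partial_deriv k f x) (at 0)"
proof -
  have "(\<lambda>t. f (x + t *\<^sub>R axis k 1)) differentiable (at (0 :: real))"
  proof (rule differentiable_compose[of f])
    show "f differentiable at (x + 0 *\<^sub>R axis k 1)"
      by (rule schwartz_differentiable[OF assms])
    show "(\<lambda>t. x + t *\<^sub>R axis k 1) differentiable (at (0 :: real))"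
      by (intro derivative_intros) 
  qed
  then show ?thesis
    unfolding partial_deriv_def by (simp add: DERIV_deriv_iff_real_differentiable)
qed

text \<open>Frechet differentiability makes every directional derivative a linear combination of the
  partial derivatives.\<close>

lemma schwartz_directional_deriv:
  fixes f :: "real ^ 'n::finite \<Rightarrow> real"
  assumes "schwartz f"
  shows "((\<lambda>s. f (x + s *\<^sub>R y)) has_real_derivative
    (\<Sum>i\<in>UNIV. y $ i * partial_deriv i f (x + s *\<^sub>R y))) (at s)"
proof -
  define D where "D = frechet_derivative f (at (x + s *\<^sub>R y))"
  have D: "(f has_derivative D) (at (x + s *\<^sub>R y))"
    using schwartz_differentiable[OF assms] unfolding D_def by (simp add: frechet_derivative_works)
  then interpret bounded_linear D
    by (rule has_derivative_bounded_linear)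
  have partial: "D (axis i 1) = partial_deriv i f (x + s *\<^sub>R y)" for i
  proof -
    have "((\<lambda>t. f ((x + s *\<^sub>R y) + t *\<^sub>R axis i 1)) has_derivative (\<lambda>t. D (t *\<^sub>R axis i 1))) (at 0)"
      by (rule has_derivative_compose[where f = "\<lambda>t. (x + s *\<^sub>R y) + t *\<^sub>R axis i 1" and g = f])
         (auto intro!: derivative_eq_intros D)
    then have "((\<lambda>t. f ((x + s *\<^sub>R y) + t *\<^sub>R axis i 1)) has_real_derivative D (axis i 1)) (at 0)"
      by (simp add: has_field_derivative_def scaleR mult.commute[of _ "D _"])
    then show ?thesis
      by (rule DERIV_unique) (rule schwartz_has_partial_deriv[OF assms])
  qed
  have "D y = D (\<Sum>i\<in>UNIV. (y $ i) *\<^sub>R axis i 1)"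
    using basis_expansion[of y] by (simp add: scalar_mult_eq_scaleR)
  also have "\<dots> = (\<Sum>i\<in>UNIV. y $ i * partial_deriv i f (x + s *\<^sub>R y))"
    by (simp add: sum scaleR partial)
  finally have Dy: "D y = (\<Sum>i\<in>UNIV. y $ i * partial_deriv i f (x + s *\<^sub>R y))" .
  have "((\<lambda>s. f (x + s *\<^sub>R y)) has_derivative (\<lambda>t. D (t *\<^sub>R y))) (at s)"
    by (rule has_derivative_compose[where f = "\<lambda>t. x + t *\<^sub>R y" and g = f])
       (auto intro!: derivative_eq_intros D)
  then show ?thesis
    by (simp add: has_field_derivative_def scaleR Dy mult.commute[of _ "\<Sum>i\<in>UNIV. _ i"])
qed

lemma schwartz_lipschitz:
  fixes f :: "real ^ 'n::finite \<Rightarrow> real"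
  assumes f: "schwartz f"
  shows "\<exists>L. \<forall>x y. \<bar>f (x + y) - f x\<bar> \<le> L * (\<Sum>i\<in>UNIV. \<bar>y $ i\<bar>)"
proof -
  have "\<exists>C. \<forall>x. \<bar>partial_deriv i f x\<bar> \<le> C" for i
    by (intro schwartz_bounded schwartz_partial_deriv f)
  then obtain C where C: "\<And>i x. \<bar>partial_deriv i f x\<bar> \<le> C i"
    by metis
  define L where "L = (\<Sum>i\<in>UNIV. C i)"
  have C0: "0 \<le> C i" for i
    using C[of i 0] by linarith
  have L: "\<bar>partial_deriv i f x\<bar> \<le> L" for i x
    unfolding L_def by (rule order_trans[OF C]) (auto intro!: member_le_sum C0)
  have "\<bar>f (x + y) - f x\<bar> \<le> L * (\<Sum>i\<in>UNIV. \<bar>y $ i\<bar>)" for x y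
  proof -
    \<comment> \<open>The mean value theorem on the segment from \<open>x\<close> to \<open>x + y\<close>.\<close>
    obtain s where s: "f (x + 1 *\<^sub>R y) - f (x + 0 *\<^sub>R y) = (1 - 0) * (\<Sum>i\<in>UNIV. y $ i * partial_deriv i f (x + s *\<^sub>R y))"
      using MVT2[of 0 1 "\<lambda>s. f (x + s *\<^sub>R y)" "\<lambda>s. \<Sum>i\<in>UNIV. y $ i * partial_deriv i f (x + s *\<^sub>R y)"]
        schwartz_directional_deriv[OF f] by (metis zero_less_one)
    have "\<bar>f (x + y) - f x\<bar> \<le> (\<Sum>i\<in>UNIV. \<bar>y $ i * partial_deriv i f (x + s *\<^sub>R y)\<bar>)"
      using s by (simp add: sum_abs)
    also have "\<dots> \<le> (\<Sum>i\<in>UNIV. \<bar>y $ i\<bar> * L)"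
      by (intro sum_mono) (simp add: abs_mult mult_left_mono L)
    finally show ?thesis
      by (simp add: sum_distrib_left mult.commute)
  qed
  then show ?thesis by blast
qed

section \<open>The Fourier transform of a Schwartz function\<close>

lemma fourier_integrand_integrable:
  fixes h :: "real ^ 'n::finite \<Rightarrow> real"
  assumes "integrable lborel h"
  shows "integrable lborel (\<lambda>x. exp (- \<i> * of_real (x \<bullet> \<xi>)) * complex_of_real (h x))"
proof (rule Bochner_Integration.integrable_bound[OF assms])
  have [measurable]: "h \<in> borel_measurable borel"
    using borel_measurable_integrable[OF assms] by simp
  show "(\<lambda>x. exp (- \<i> * of_real (x \<bullet> \<xi>)) * complex_of_real (h x)) \<in> borel_measurable lborel"
    by measurable
qed (simp add: norm_mult)

lemma norm_fourier_le:
  fixes h :: "real ^ 'n::finite \<Rightarrow> real"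
  shows "norm (fourier (\<lambda>x. of_real (h x)) \<xi>) \<le> (\<integral>x. \<bar>h x\<bar> \<partial>lborel)"
  unfolding fourier_def by (rule order_trans[OF integral_norm_bound]) (simp add: norm_mult)

text \<open>The integral of the partial derivative of \<open>exp (- \<i> * (x \<bullet> \<xi>)) * h x\<close> vanishes.\<close>

lemma fourier_partial_deriv:
  fixes h :: "real ^ 'n::finite \<Rightarrow> real"
  assumes h: "schwartz h"
  shows "fourier (\<lambda>x. of_real (partial_deriv k h x)) \<xi>
    = \<i> * of_real (\<xi> $ k) * fourier (\<lambda>x. of_real (h x)) \<xi>"
proof -
  define E where "E x = exp (- \<i> * of_real (x \<bullet> \<xi>))" for x
  define H where "H x = E x * complex_of_real (h x)" for x
  define H' where "H' x = E x * complex_of_real (partial_deriv k h x)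
    - \<i> * of_real (\<xi> $ k) * (E x * complex_of_real (h x))" for x
  obtain C where C: "\<And>x. \<bar>h x\<bar> \<le> C * decay_weight x"
    using schwartz_le_decay_weight[OF h] by blast
  obtain C' where C': "\<And>x. \<bar>partial_deriv k h x\<bar> \<le> C' * decay_weight x"
    using schwartz_le_decay_weight[OF schwartz_partial_deriv[OF h]] by blast
  have nE: "norm (E x) = 1" for x
    by (simp add: E_def)
  have "(\<integral>x. H' x \<partial>lborel) = 0"
  proof (rule integral_partial_deriv_zero)
    fix x :: "real ^ 'n"
    have "((\<lambda>t. h (x + t *\<^sub>R axis k 1)) has_vector_derivative partial_deriv k h x) (at 0)"
      using schwartz_has_partial_deriv[OF h, of x k]
      by (simp add: has_real_derivative_iff_has_vector_derivative)
    then have 1: "((\<lambda>t. complex_of_real (h (x + t *\<^sub>R axis k 1))) has_vector_derivative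
        of_real (partial_deriv k h x)) (at 0)"
      by (rule bounded_linear.has_vector_derivative[OF bounded_linear_of_real])
    have "((\<lambda>t. E (x + t *\<^sub>R axis k 1)) has_vector_derivative - \<i> * of_real (\<xi> $ k) * E x) (at 0)"
    proof -
      have "E (x + t *\<^sub>R axis k 1) = E x * exp (t *\<^sub>R (- \<i> * of_real (\<xi> $ k)))" for t
      proof -
        have "(x + t *\<^sub>R axis k 1) \<bullet> \<xi> = x \<bullet> \<xi> + t * \<xi> $ k"
          by (simp add: inner_add_left inner_axis')
        then show ?thesis
          by (simp add: E_def scaleR_conv_of_real exp_add[symmetric] algebra_simps)
      qed
      then show ?thesis
        using has_vector_derivative_mult_right[OF exp_scaleR_has_vector_derivative_right,
            of "E x" "- \<i> * of_real (\<xi> $ k)" 0 UNIV]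
        by (simp add: mult_ac)
    qed
    from has_vector_derivative_mult[OF this 1]
    show "((\<lambda>t. H (x + t *\<^sub>R axis k 1)) has_vector_derivative H' x) (at 0)"
      by (simp add: H_def H'_def algebra_simps)
    have "norm (H' x) \<le> \<bar>partial_deriv k h x\<bar> + \<bar>\<xi> $ k\<bar> * \<bar>h x\<bar>"
      unfolding H'_def by (rule order_trans[OF norm_triangle_ineq4]) (simp add: norm_mult nE)
    also have "\<dots> \<le> C' * decay_weight x + \<bar>\<xi> $ k\<bar> * (C * decay_weight x)"
      by (intro add_mono mult_left_mono C C') auto
    finally show "norm (H' x) \<le> (C' + \<bar>\<xi> $ k\<bar> * C) * decay_weight x"
      by (simp add: algebra_simps)
  next
    show "integrable lborel H"
      unfolding H_def E_def by (rule fourier_integrand_integrable[OF schwartz_integrable[OF h]])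
  qed
  then show ?thesis
    unfolding H'_def E_def fourier_def
    using fourier_integrand_integrable[OF schwartz_integrable[OF h], of \<xi>]
      fourier_integrand_integrable[OF schwartz_integrable[OF schwartz_partial_deriv[OF h]], of \<xi> k]
    by (subst (asm) Bochner_Integration.integral_diff) auto
qed

text \<open>Induction on \<open>N\<close> for all Schwartz functions at once: \<open>norm \<xi>\<close> is at most the sum of the
  \<open>\<bar>\<xi> $ i\<bar>\<close>, and the factor \<open>\<xi> $ i\<close> is absorbed into the Fourier transform of a partial
  derivative.\<close>

lemma fourier_decay:
  fixes h :: "real ^ 'n::finite \<Rightarrow> real"
  assumes "schwartz h"
  shows "\<exists>C. \<forall>\<xi>. (1 + norm \<xi>) ^ N * norm (fourier (\<lambda>x. of_real (h x)) \<xi>) \<le> C"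
  using assms
proof (induction N arbitrary: h)
  case 0
  then show ?case
    using norm_fourier_le by auto
next
  case (Suc N)
  let ?F = "\<lambda>h \<xi>. (1 + norm \<xi>) ^ N * norm (fourier (\<lambda>x. of_real (h x)) \<xi>)"
  obtain C where C: "\<And>\<xi>. ?F h \<xi> \<le> C"
    using Suc by blast
  have "\<exists>C. \<forall>\<xi>. ?F (partial_deriv i h) \<xi> \<le> C" for i
    by (intro Suc.IH schwartz_partial_deriv Suc.prems)
  then obtain D where D: "\<And>i \<xi>. ?F (partial_deriv i h) \<xi> \<le> D i"
    by metis
  have "(1 + norm \<xi>) ^ Suc N * norm (fourier (\<lambda>x. of_real (h x)) \<xi>) \<le> C + (\<Sum>i\<in>UNIV. D i)" for \<xi>
  proof -
    have "(1 + norm \<xi>) ^ Suc N * norm (fourier (\<lambda>x. of_real (h x)) \<xi>) = (1 + norm \<xi>) * ?F h \<xi>"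
      by simp
    also have "\<dots> \<le> (1 + (\<Sum>i\<in>UNIV. \<bar>\<xi> $ i\<bar>)) * ?F h \<xi>"
      using norm_le_l1_cart[of \<xi>] by (intro mult_right_mono) auto
    also have "\<dots> = ?F h \<xi> + (\<Sum>i\<in>UNIV. \<bar>\<xi> $ i\<bar> * ?F h \<xi>)"
      by (simp only: distrib_right sum_distrib_right mult_1)
    also have "\<dots> = ?F h \<xi> + (\<Sum>i\<in>UNIV. ?F (partial_deriv i h) \<xi>)"
      by (simp add: fourier_partial_deriv[OF Suc.prems] norm_mult mult.left_commute)
    also have "\<dots> \<le> C + (\<Sum>i\<in>UNIV. D i)"
      by (intro add_mono sum_mono C D)
    finally show ?thesis .
  qed
  then show ?case by blast
qed

lemma fourier_measurable [measurable]:
  fixes h :: "real ^ 'n::finite \<Rightarrow> real"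
  assumes [measurable]: "h \<in> borel_measurable borel"
  shows "fourier (\<lambda>x. of_real (h x)) \<in> borel_measurable borel"
  unfolding fourier_def[abs_def] by measurable

lemma integrable_fourier_powr:
  fixes h :: "real ^ 'n::finite \<Rightarrow> real"
  assumes h: "schwartz h" and a: "0 \<le> a" "a \<le> 2"
  shows "integrable lborel (\<lambda>\<xi>. of_real (norm \<xi> powr a) * fourier (\<lambda>x. of_real (h x)) \<xi>)"
proof -
  have [measurable]: "h \<in> borel_measurable borel"
    by (rule schwartz_measurable[OF h])
  obtain C where C: "\<And>\<xi>. (1 + norm \<xi>) ^ (2 * CARD('n) + 2) * norm (fourier (\<lambda>x. of_real (h x)) \<xi>) \<le> C"
    using fourier_decay[OF h] by blast
  show ?thesis
  proof (rule integrable_if_decay)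
    fix \<xi> :: "real ^ 'n"
    have "norm \<xi> powr a \<le> (1 + norm \<xi>) powr a"
      using a by (intro powr_mono2) auto
    also have "\<dots> \<le> (1 + norm \<xi>) powr 2"
      using a by (intro powr_mono) auto
    also have "\<dots> = (1 + norm \<xi>) ^ 2"
      by (simp add: add_pos_nonneg)
    finally have p: "norm \<xi> powr a \<le> (1 + norm \<xi>) ^ 2" .
    have "norm (of_real (norm \<xi> powr a) * fourier (\<lambda>x. of_real (h x)) \<xi>)
        \<le> (1 + norm \<xi>) ^ 2 * norm (fourier (\<lambda>x. of_real (h x)) \<xi>)"
      using p by (simp add: norm_mult mult_right_mono)
    also have "\<dots> \<le> C * decay_weight \<xi>"
    proof -
      have "0 < (1 + norm \<xi>) ^ (2 * CARD('n))"
        by (simp add: add_pos_nonneg)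
      then show ?thesis
        using C[of \<xi>] by (simp add: decay_weight_def pos_le_divide_eq power_add power2_eq_square mult_ac)
    qed
    finally show "norm (of_real (norm \<xi> powr a) * fourier (\<lambda>x. of_real (h x)) \<xi>) \<le> C * decay_weight \<xi>" .
  qed measurable
qed

lemma integrable_fourier:
  fixes h :: "real ^ 'n::finite \<Rightarrow> real"
  assumes h: "schwartz h"
  shows "integrable lborel (fourier (\<lambda>x. of_real (h x)))"
proof -
  have [measurable]: "h \<in> borel_measurable borel"
    by (rule schwartz_measurable[OF h])
  obtain C where C: "\<And>\<xi>. (1 + norm \<xi>) ^ (2 * CARD('n)) * norm (fourier (\<lambda>x. of_real (h x)) \<xi>) \<le> C"
    using fourier_decay[OF h] by blast
  show ?thesis
  proof (rule integrable_if_decay)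
    fix \<xi> :: "real ^ 'n"
    have "0 < (1 + norm \<xi>) ^ (2 * CARD('n))"
      by (simp add: add_pos_nonneg)
    then show "norm (fourier (\<lambda>x. of_real (h x)) \<xi>) \<le> C * decay_weight \<xi>"
      using C[of \<xi>] by (simp add: decay_weight_def field_simps)
  qed measurable
qed

section \<open>Gaussians\<close>

text \<open>The density of independent centred normal coordinates of standard deviation \<open>\<sigma>\<close>.\<close>

definition gauss :: "real \<Rightarrow> real ^ 'n::finite \<Rightarrow> real" where
  "gauss \<sigma> y = (\<Prod>i\<in>UNIV. normal_density 0 \<sigma> (y $ i))"

lemma gauss_nonneg: "0 \<le> gauss \<sigma> y"
  unfolding gauss_def by (intro prod_nonneg) auto

lemma gauss_measurable [measurable]: "gauss \<sigma> \<in> borel_measurable borel"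
  unfolding gauss_def[abs_def] by measurable

lemma gauss_eq_exp:
  fixes y :: "real ^ 'n::finite"
  shows "gauss \<sigma> y = (1 / sqrt (2 * pi * \<sigma>\<^sup>2)) ^ CARD('n) * exp (- (norm y)\<^sup>2 / (2 * \<sigma>\<^sup>2))"
proof -
  have "(norm y)\<^sup>2 = (\<Sum>i\<in>UNIV. (y $ i)\<^sup>2)"
    by (simp add: norm_vec_def L2_set_def sum_nonneg)
  then have "exp (- (norm y)\<^sup>2 / (2 * \<sigma>\<^sup>2)) = (\<Prod>i\<in>UNIV. exp (- (y $ i)\<^sup>2 / (2 * \<sigma>\<^sup>2)))"
    by (simp add: exp_sum[symmetric] sum_negf sum_divide_distrib[symmetric])
  then show ?thesis
    unfolding gauss_def normal_density_def by (simp add: prod_dividef power_one_over)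
qed

lemma gauss_le: "gauss \<sigma> (y :: real ^ 'n::finite) \<le> gauss \<sigma> (0 :: real ^ 'n)"
  unfolding gauss_eq_exp by (intro mult_left_mono) auto

lemma
  assumes "0 < \<sigma>"
  shows integrable_gauss: "integrable lborel (gauss \<sigma> :: real ^ 'n::finite \<Rightarrow> real)"
    and integral_gauss: "(\<integral>y. gauss \<sigma> (y :: real ^ 'n) \<partial>lborel) = 1"
proof -
  have int: "integrable lborel (normal_density 0 \<sigma>)"
    using assms by simp
  show "integrable lborel (gauss \<sigma> :: real ^ 'n::finite \<Rightarrow> real)"
    unfolding gauss_def[abs_def] by (rule integrable_lborel_vec_prod[OF int])
  show "(\<integral>y. gauss \<sigma> (y :: real ^ 'n) \<partial>lborel) = 1"
    unfolding gauss_def integral_lborel_vec_prod[OF int] using assms by simp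
qed

lemma
  assumes s: "0 < \<sigma>"
  shows integrable_gauss_moment: "integrable lborel (\<lambda>y :: real ^ 'n::finite. \<bar>y $ k\<bar> * gauss \<sigma> y)"
    and integral_gauss_moment: "(\<integral>y. \<bar>(y :: real ^ 'n) $ k\<bar> * gauss \<sigma> y \<partial>lborel) \<le> \<sigma>"
proof -
  \<comment> \<open>Putting the factor \<open>\<bar>y $ k\<bar>\<close> into the \<open>k\<close>-th density keeps the integrand a product.\<close>
  define p where "p i = (\<lambda>t. (if i = k then \<bar>t\<bar> else 1) * normal_density 0 \<sigma> t)" for i
  have eq: "\<bar>y $ k\<bar> * gauss \<sigma> y = (\<Prod>i\<in>UNIV. p i (y $ i))" for y :: "real ^ 'n"
    unfolding gauss_def p_def prod.distrib by (simp add: prod.delta)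
  have pk: "has_bochner_integral lborel (p k) (\<sigma> * sqrt (2 / pi))"
    using normal_moment_abs_odd[OF s, of 0 0] by (simp add: p_def mult.commute)
  have po: "has_bochner_integral lborel (p i) 1" if "i \<noteq> k" for i
    using that s by (simp add: p_def has_bochner_integral_iff)
  have int: "integrable lborel (p i)" for i
    using pk po by (cases "i = k") (auto simp: has_bochner_integral_iff)
  show "integrable lborel (\<lambda>y :: real ^ 'n. \<bar>y $ k\<bar> * gauss \<sigma> y)"
    unfolding eq by (rule integrable_lborel_vec_prod[OF int])
  have "(\<integral>y. \<bar>(y :: real ^ 'n) $ k\<bar> * gauss \<sigma> y \<partial>lborel) = (\<Prod>i\<in>UNIV. \<integral>t. p i t \<partial>lborel)"
    unfolding eq by (rule integral_lborel_vec_prod[OF int])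
  also have "\<dots> = (\<Prod>i\<in>UNIV. if i = k then \<sigma> * sqrt (2 / pi) else 1)"
    using pk po by (intro prod.cong) (auto simp: has_bochner_integral_iff)
  also have "\<dots> = \<sigma> * sqrt (2 / pi)"
    by (simp add: prod.delta)
  also have "\<dots> \<le> \<sigma>"
    using s pi_gt3 by (intro mult_right_le_one_le) auto
  finally show "(\<integral>y. \<bar>(y :: real ^ 'n) $ k\<bar> * gauss \<sigma> y \<partial>lborel) \<le> \<sigma>" .
qed

lemma
  assumes s: "0 < \<sigma>"
  shows integrable_exp_gauss_1d:
      "integrable lborel (\<lambda>x. exp (\<i> * of_real (z * x)) * of_real (exp (- \<sigma>\<^sup>2 * x\<^sup>2 / 2)))"
    and integral_exp_gauss_1d:
      "(\<integral>x. exp (\<i> * of_real (z * x)) * of_real (exp (- \<sigma>\<^sup>2 * x\<^sup>2 / 2)) \<partial>lborel)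
        = of_real (2 * pi * normal_density 0 \<sigma> z)"
proof -
  \<comment> \<open>The substitution \<open>x \<mapsto> \<sigma> x\<close> reduces to the characteristic function of the
    standard normal law at \<open>z / \<sigma>\<close>.\<close>
  define F where "F x = complex_of_real (std_normal_density x) * exp (\<i> * of_real (z / \<sigma> * x))" for x
  have eq: "exp (\<i> * of_real (z * x)) * of_real (exp (- \<sigma>\<^sup>2 * x\<^sup>2 / 2))
      = of_real (sqrt (2 * pi)) * F (0 + \<sigma> * x)" for x
    using s by (simp add: F_def std_normal_density_def power_mult_distrib)
  have F: "integrable lborel F"
    by (rule Bochner_Integration.integrable_bound[of _ std_normal_density]) (auto simp: F_def[abs_def] norm_mult)
  then have F': "integrable lborel (\<lambda>x. F (0 + \<sigma> * x))"
    using s by (intro lborel_integrable_real_affine) auto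
  then show "integrable lborel (\<lambda>x. exp (\<i> * of_real (z * x)) * of_real (exp (- \<sigma>\<^sup>2 * x\<^sup>2 / 2)))"
    unfolding eq by (rule integrable_mult_right)
  have "(\<integral>x. F x \<partial>lborel) = char std_normal_distribution (z / \<sigma>)"
    unfolding char_def F_def
    by (subst integral_density) (auto simp: scaleR_conv_of_real)
  also have "\<dots> = of_real (exp (- ((z / \<sigma>)\<^sup>2) / 2))"
    by (simp add: char_std_normal_distribution)
  finally have iF: "(\<integral>x. F x \<partial>lborel) = of_real (exp (- ((z / \<sigma>)\<^sup>2) / 2))" .
  have "(\<integral>x. F x \<partial>lborel) = \<bar>\<sigma>\<bar> *\<^sub>R (\<integral>x. F (0 + \<sigma> * x) \<partial>lborel)"
    using s by (intro lborel_integral_real_affine) auto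
  then have scaled: "(\<integral>x. F (0 + \<sigma> * x) \<partial>lborel) = of_real (exp (- ((z / \<sigma>)\<^sup>2) / 2) / \<sigma>)"
    using s iF by (simp add: scaleR_conv_of_real field_simps)
  have "(\<integral>x. exp (\<i> * of_real (z * x)) * of_real (exp (- \<sigma>\<^sup>2 * x\<^sup>2 / 2)) \<partial>lborel)
      = of_real (sqrt (2 * pi)) * of_real (exp (- ((z / \<sigma>)\<^sup>2) / 2) / \<sigma>)"
    unfolding eq integral_mult_right_zero scaled ..
  also have "\<dots> = of_real (sqrt (2 * pi) * (exp (- ((z / \<sigma>)\<^sup>2) / 2) / \<sigma>))"
    by (rule of_real_mult[symmetric])
  also have "sqrt (2 * pi) * (exp (- ((z / \<sigma>)\<^sup>2) / 2) / \<sigma>) = 2 * pi * normal_density 0 \<sigma> z"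
    using s by (simp add: normal_density_def real_sqrt_mult power_divide field_simps)
  finally show "(\<integral>x. exp (\<i> * of_real (z * x)) * of_real (exp (- \<sigma>\<^sup>2 * x\<^sup>2 / 2)) \<partial>lborel)
        = of_real (2 * pi * normal_density 0 \<sigma> z)" .
qed

lemma
  fixes z :: "real ^ 'n::finite"
  assumes s: "0 < \<sigma>"
  shows integrable_exp_gauss:
      "integrable lborel (\<lambda>\<xi>. exp (\<i> * of_real (z \<bullet> \<xi>)) * of_real (exp (- \<sigma>\<^sup>2 * (norm \<xi>)\<^sup>2 / 2)))"
    and integral_exp_gauss:
      "(\<integral>\<xi>. exp (\<i> * of_real (z \<bullet> \<xi>)) * of_real (exp (- \<sigma>\<^sup>2 * (norm \<xi>)\<^sup>2 / 2)) \<partial>lborel)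
        = of_real ((2 * pi) ^ CARD('n) * gauss \<sigma> z)"
proof -
  have n: "(norm \<xi>)\<^sup>2 = (\<Sum>i\<in>UNIV. (\<xi> $ i)\<^sup>2)" for \<xi> :: "real ^ 'n"
    by (simp add: norm_vec_def L2_set_def sum_nonneg)
  have e1: "exp (\<i> * of_real (z \<bullet> \<xi>)) = (\<Prod>i\<in>UNIV. exp (\<i> * of_real (z $ i * \<xi> $ i)))" for \<xi>
    by (simp add: inner_vec_def exp_sum[symmetric] sum_distrib_left)
  have e2: "exp (- \<sigma>\<^sup>2 * (norm \<xi>)\<^sup>2 / 2) = (\<Prod>i\<in>UNIV. exp (- \<sigma>\<^sup>2 * (\<xi> $ i)\<^sup>2 / 2))" for \<xi> :: "real ^ 'n"
    unfolding n by (simp add: exp_sum[symmetric] sum_negf sum_divide_distrib sum_distrib_left)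
  have eq: "exp (\<i> * of_real (z \<bullet> \<xi>)) * of_real (exp (- \<sigma>\<^sup>2 * (norm \<xi>)\<^sup>2 / 2))
      = (\<Prod>i\<in>UNIV. exp (\<i> * of_real (z $ i * \<xi> $ i)) * of_real (exp (- \<sigma>\<^sup>2 * (\<xi> $ i)\<^sup>2 / 2)))" for \<xi>
    unfolding e1 e2 prod.distrib of_real_prod ..
  show "integrable lborel (\<lambda>\<xi>. exp (\<i> * of_real (z \<bullet> \<xi>)) * of_real (exp (- \<sigma>\<^sup>2 * (norm \<xi>)\<^sup>2 / 2)))"
    unfolding eq by (rule integrable_lborel_vec_prod) (rule integrable_exp_gauss_1d[OF s])
  show "(\<integral>\<xi>. exp (\<i> * of_real (z \<bullet> \<xi>)) * of_real (exp (- \<sigma>\<^sup>2 * (norm \<xi>)\<^sup>2 / 2)) \<partial>lborel)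
        = of_real ((2 * pi) ^ CARD('n) * gauss \<sigma> z)"
    unfolding eq 
    by (subst integral_lborel_vec_prod[OF integrable_exp_gauss_1d[OF s]])
       (simp only: integral_exp_gauss_1d[OF s], simp add: gauss_def prod.distrib)
qed

lemma integrable_exp_norm_square:
  assumes "0 < \<sigma>"
  shows "integrable lborel (\<lambda>\<xi> :: real ^ 'n::finite. exp (- \<sigma>\<^sup>2 * (norm \<xi>)\<^sup>2 / 2))"
  using integrable_norm[OF integrable_exp_gauss[OF assms, of "0 :: real ^ 'n"]] by simp

lemma gauss_partial_deriv:
  fixes x y :: "real ^ 'n::finite"
  assumes s: "0 < \<sigma>"
  shows "((\<lambda>t. gauss \<sigma> (x - (y + t *\<^sub>R axis k 1))) has_real_derivative
    ((x - y) $ k / \<sigma>\<^sup>2) * gauss \<sigma> (x - y)) (at 0)"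
proof -
  have n: "(norm (x - (y + t *\<^sub>R axis k 1)))\<^sup>2 = (norm (x - y))\<^sup>2 - 2 * t * (x - y) $ k + t\<^sup>2" for t
  proof -
    have "x - (y + t *\<^sub>R axis k 1) = (x - y) - t *\<^sub>R axis k 1"
      by simp
    then show ?thesis
      unfolding power2_norm_eq_inner
      by (simp only: inner_diff_left inner_diff_right)
         (simp add: inner_axis inner_axis' power2_eq_square algebra_simps)
  qed
  show ?thesis
    unfolding gauss_eq_exp n using s
    by (auto intro!: derivative_eq_intros simp: field_simps power2_eq_square)
qed

section \<open>The heat semigroup\<close>

text \<open>Convolution with a Gaussian. The parameter is the standard deviation \<open>\<sigma>\<close>, not the time: this is
  the heat semigroup of the Laplacian at time \<open>\<sigma>\<^sup>2 / 2\<close>.\<close>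

definition heat :: "real \<Rightarrow> (real ^ 'n::finite \<Rightarrow> real) \<Rightarrow> real ^ 'n \<Rightarrow> real" where
  "heat \<sigma> h x = (\<integral>y. gauss \<sigma> (x - y) * h y \<partial>lborel)"

lemma integrable_heat:
  fixes h :: "real ^ 'n::finite \<Rightarrow> real"
  assumes s: "0 < \<sigma>" and [measurable]: "h \<in> borel_measurable borel" and b: "\<And>x. \<bar>h x\<bar> \<le> B"
  shows "integrable lborel (\<lambda>y. gauss \<sigma> (x - y) * h y)"
proof (rule Bochner_Integration.integrable_bound)
  show "integrable lborel (\<lambda>y. gauss \<sigma> (x - y) * B)"
    by (intro integrable_mult_left integrable_reflect integrable_gauss s)
  show "AE y in lborel. norm (gauss \<sigma> (x - y) * h y) \<le> norm (gauss \<sigma> (x - y) * B)"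
    by (intro AE_I2) (auto simp: abs_mult intro!: mult_left_mono order_trans[OF b abs_ge_self])
qed measurable

lemma heat_le:
  fixes h :: "real ^ 'n::finite \<Rightarrow> real"
  assumes s: "0 < \<sigma>" and m: "h \<in> borel_measurable borel" and b: "\<And>x. \<bar>h x\<bar> \<le> B"
    and le: "\<And>y. h y \<le> M"
  shows "heat \<sigma> h x \<le> M"
proof -
  have "heat \<sigma> h x \<le> (\<integral>y. gauss \<sigma> (x - y) * M \<partial>lborel)"
    unfolding heat_def
    by (intro integral_mono integrable_heat[OF s m b] integrable_mult_left integrable_reflect
        integrable_gauss s mult_left_mono le gauss_nonneg)
  also have "\<dots> = M"
    using integral_reflect[of "gauss \<sigma>" x] integral_gauss[OF s, where 'n = 'n] by simp
  finally show ?thesis .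
qed

text \<open>The heat semigroup as a Fourier multiplier. Inserting the definition of the Fourier transform
  and exchanging the integrals leaves the inverse Fourier transform of a Gaussian inside; the
  inversion formula for \<open>h\<close> itself is not used.\<close>

lemma heat_fourier:
  fixes h :: "real ^ 'n::finite \<Rightarrow> real"
  assumes h: "schwartz h" and s: "0 < \<sigma>"
  shows "(\<integral>\<xi>. exp (\<i> * of_real (x \<bullet> \<xi>)) * of_real (exp (- \<sigma>\<^sup>2 * (norm \<xi>)\<^sup>2 / 2)) *
      fourier (\<lambda>y. of_real (h y)) \<xi> \<partial>lborel) = of_real ((2 * pi) ^ CARD('n) * heat \<sigma> h x)"
proof -
  note [measurable] = schwartz_measurable[OF h]
  define G where "G \<xi> = exp (- \<sigma>\<^sup>2 * (norm \<xi>)\<^sup>2 / 2)" for \<xi> :: "real ^ 'n"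
  define K where "K \<xi> y = exp (\<i> * of_real (x \<bullet> \<xi>)) * of_real (G \<xi>) *
     (exp (- \<i> * of_real (y \<bullet> \<xi>)) * complex_of_real (h y))" for \<xi> y
  have G [measurable]: "G \<in> borel_measurable borel" "integrable lborel G"
    unfolding G_def[abs_def] using integrable_exp_norm_square[OF s] by auto
  have nK: "norm (K \<xi> y) = G \<xi> * \<bar>h y\<bar>" for \<xi> y
    by (simp add: K_def norm_mult G_def)
  have int: "integrable (lborel \<Otimes>\<^sub>M lborel) (\<lambda>(\<xi>, y). K \<xi> y)"
  proof (rule lborel_pair.Fubini_integrable)
    show "(\<lambda>(\<xi>, y). K \<xi> y) \<in> borel_measurable (lborel \<Otimes>\<^sub>M lborel)"
      unfolding K_def by measurable
    show "integrable lborel (\<lambda>\<xi>. \<integral>y. norm (case (\<xi>, y) of (\<xi>, y) \<Rightarrow> K \<xi> y) \<partial>lborel)"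
      using G by (simp add: nK)
    have "integrable lborel (\<lambda>y. K \<xi> y)" for \<xi>
      unfolding K_def
      by (intro integrable_mult_right fourier_integrand_integrable schwartz_integrable h)
    then show "AE \<xi> in lborel. integrable lborel (\<lambda>y. case (\<xi>, y) of (\<xi>, y) \<Rightarrow> K \<xi> y)"
      by simp
  qed
  have "(\<integral>\<xi>. exp (\<i> * of_real (x \<bullet> \<xi>)) * of_real (G \<xi>) * fourier (\<lambda>y. of_real (h y)) \<xi> \<partial>lborel)
      = (\<integral>\<xi>. (\<integral>y. K \<xi> y \<partial>lborel) \<partial>lborel)"
    by (simp add: K_def fourier_def)
  also have "\<dots> = (\<integral>y. (\<integral>\<xi>. K \<xi> y \<partial>lborel) \<partial>lborel)"
    by (rule lborel_pair.Fubini_integral[OF int, symmetric])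
  also have "\<dots> = (\<integral>y. of_real ((2 * pi) ^ CARD('n) * (gauss \<sigma> (x - y) * h y)) \<partial>lborel)"
  proof (rule Bochner_Integration.integral_cong[OF refl])
    fix y
    have "K \<xi> y = of_real (h y) * (exp (\<i> * of_real ((x - y) \<bullet> \<xi>)) * of_real (exp (- \<sigma>\<^sup>2 * (norm \<xi>)\<^sup>2 / 2)))" for \<xi>
      by (simp add: K_def G_def inner_diff_left exp_diff exp_minus field_simps)
    then show "(\<integral>\<xi>. K \<xi> y \<partial>lborel) = of_real ((2 * pi) ^ CARD('n) * (gauss \<sigma> (x - y) * h y))"
      by (simp only: integral_mult_right_zero integral_exp_gauss[OF s]) simp
  qed
  also have "\<dots> = of_real ((2 * pi) ^ CARD('n) * heat \<sigma> h x)"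
    unfolding heat_def by (subst integral_complex_of_real) simp
  finally show ?thesis by (simp add: G_def)
qed

text \<open>The rate comes from the Lipschitz bound for \<open>h\<close> and the first absolute moments of the Gaussian.\<close>

lemma abs_heat_minus_self_le:
  fixes h :: "real ^ 'n::finite \<Rightarrow> real"
  assumes h: "schwartz h"
  shows "\<exists>L. \<forall>\<sigma>>0. \<bar>heat \<sigma> h x - h x\<bar> \<le> L * \<sigma>"
proof -
  obtain L where L: "\<And>x y. \<bar>h (x + y) - h x\<bar> \<le> L * (\<Sum>i\<in>UNIV. \<bar>y $ i\<bar>)"
    using schwartz_lipschitz[OF h] by blast
  obtain B where B: "\<And>x. \<bar>h x\<bar> \<le> B"
    using schwartz_bounded[OF h] by blast
  have L0: "0 \<le> L"
  proof -
    have "0 \<le> L * (\<Sum>i\<in>UNIV. \<bar>(1 :: real ^ 'n) $ i\<bar>)"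
      using L[of 0 1] by linarith
    then show ?thesis by (simp add: zero_le_mult_iff)
  qed
  note m [measurable] = schwartz_measurable[OF h]
  have "\<bar>heat \<sigma> h x - h x\<bar> \<le> L * CARD('n) * \<sigma>" if s: "0 < \<sigma>" for \<sigma>
  proof -
    note int = integrable_heat[OF s m B, of x]
    have int': "integrable lborel (\<lambda>y. gauss \<sigma> (x - y) * h x)"
      by (intro integrable_mult_left integrable_reflect integrable_gauss s)
    have intm: "integrable lborel (\<lambda>y. L * (\<Sum>i\<in>UNIV. \<bar>(y :: real ^ 'n) $ i\<bar> * gauss \<sigma> y))"
      by (intro integrable_mult_right Bochner_Integration.integrable_sum integrable_gauss_moment s)
    have "h x = (\<integral>y. gauss \<sigma> (x - y) * h x \<partial>lborel)"
      using integral_reflect[of "gauss \<sigma>" x] integral_gauss[OF s, where 'n = 'n] by simp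
    then have "heat \<sigma> h x - h x = (\<integral>y. gauss \<sigma> (x - y) * h y - gauss \<sigma> (x - y) * h x \<partial>lborel)"
      unfolding heat_def by (simp add: Bochner_Integration.integral_diff[OF int int'])
    also have "\<bar>\<dots>\<bar> \<le> (\<integral>y. \<bar>gauss \<sigma> (x - y) * h y - gauss \<sigma> (x - y) * h x\<bar> \<partial>lborel)"
      by (rule integral_abs_bound)
    also have "\<dots> \<le> (\<integral>y. L * (\<Sum>i\<in>UNIV. \<bar>(x - y) $ i\<bar> * gauss \<sigma> (x - y)) \<partial>lborel)"
    proof (rule integral_mono)
      show "integrable lborel (\<lambda>y. \<bar>gauss \<sigma> (x - y) * h y - gauss \<sigma> (x - y) * h x\<bar>)"
        using int int' by auto
      show "integrable lborel (\<lambda>y. L * (\<Sum>i\<in>UNIV. \<bar>(x - y) $ i\<bar> * gauss \<sigma> (x - y)))"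
        by (rule integrable_reflect[OF intm])
      fix y
      have "\<bar>gauss \<sigma> (x - y) * h y - gauss \<sigma> (x - y) * h x\<bar> = gauss \<sigma> (x - y) * \<bar>h (x + (y - x)) - h x\<bar>"
        by (simp add: right_diff_distrib[symmetric] abs_mult gauss_nonneg)
      also have "\<dots> \<le> gauss \<sigma> (x - y) * (L * (\<Sum>i\<in>UNIV. \<bar>(y - x) $ i\<bar>))"
        by (intro mult_left_mono L gauss_nonneg)
      also have "\<dots> = L * (\<Sum>i\<in>UNIV. \<bar>(x - y) $ i\<bar> * gauss \<sigma> (x - y))"
        by (simp add: sum_distrib_left sum_distrib_right abs_minus_commute mult_ac)
      finally show "\<bar>gauss \<sigma> (x - y) * h y - gauss \<sigma> (x - y) * h x\<bar>
        \<le> L * (\<Sum>i\<in>UNIV. \<bar>(x - y) $ i\<bar> * gauss \<sigma> (x - y))" .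
    qed
    also have "\<dots> = (\<integral>y. L * (\<Sum>i\<in>UNIV. \<bar>(y :: real ^ 'n) $ i\<bar> * gauss \<sigma> y) \<partial>lborel)"
      by (rule integral_reflect[of "\<lambda>y :: real ^ 'n. L * (\<Sum>i\<in>UNIV. \<bar>y $ i\<bar> * gauss \<sigma> y)"]) measurable
    also have "\<dots> = L * (\<Sum>i\<in>UNIV. \<integral>y. \<bar>(y :: real ^ 'n) $ i\<bar> * gauss \<sigma> y \<partial>lborel)"
      using integrable_gauss_moment[OF s, where 'n = 'n] by simp
    also have "\<dots> \<le> L * (\<Sum>i\<in>(UNIV :: 'n set). \<sigma>)"
      by (intro mult_left_mono sum_mono integral_gauss_moment s L0)
    finally show ?thesis by (simp add: mult.assoc)
  qed
  then show ?thesis by blast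
qed

text \<open>The smoothing estimate: the derivative is moved from \<open>f\<close> to the Gaussian, and the first absolute
  moment of a coordinate is at most \<open>\<sigma>\<close>. Only an almost everywhere bound on \<open>f\<close> enters, as the
  essential supremum provides it.\<close>

lemma heat_partial_deriv_le:
  fixes f :: "real ^ 'n::finite \<Rightarrow> real"
  assumes f: "schwartz f" and s: "0 < \<sigma>" and M: "AE x in lborel. \<bar>f x\<bar> \<le> M"
  shows "\<bar>heat \<sigma> (partial_deriv k f) x\<bar> \<le> M / \<sigma>"
proof -
  define g where "g = partial_deriv k f"
  have g: "schwartz g"
    unfolding g_def by (rule schwartz_partial_deriv[OF f])
  note mf [measurable] = schwartz_measurable[OF f] and mg [measurable] = schwartz_measurable[OF g]
  obtain B where B: "\<And>y. \<bar>f y\<bar> \<le> B"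
    using schwartz_bounded[OF f] by blast
  obtain B' where B': "\<And>y. \<bar>g y\<bar> \<le> B'"
    using schwartz_bounded[OF g] by blast
  obtain C where C: "\<And>y. (1 + norm y) * \<bar>f y\<bar> \<le> C * decay_weight y"
    using schwartz_norm_mult_le_decay_weight[OF f] by blast
  obtain C' where C': "\<And>y. \<bar>g y\<bar> \<le> C' * decay_weight y"
    using schwartz_le_decay_weight[OF g] by blast
  define G :: real where "G = gauss \<sigma> (0 :: real ^ 'n)"
  have G0: "0 \<le> G"
    unfolding G_def by (rule gauss_nonneg)
  define D where "D y = ((x - y) $ k / \<sigma>\<^sup>2) * gauss \<sigma> (x - y) * f y" for y
  have intg: "integrable lborel (\<lambda>y. gauss \<sigma> (x - y) * g y)"
    by (rule integrable_heat[OF s mg B'])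
  have Dle: "\<bar>D y\<bar> \<le> ((1 + norm x) / \<sigma>\<^sup>2 * G * C) * decay_weight y" for y
  proof -
    have "\<bar>(x - y) $ k\<bar> \<le> norm x + norm y"
      by (rule order_trans[OF component_le_norm_cart norm_triangle_ineq4])
    also have "\<dots> \<le> (1 + norm x) * (1 + norm y)"
      by (simp add: algebra_simps)
    finally have b: "\<bar>(x - y) $ k\<bar> \<le> (1 + norm x) * (1 + norm y)" .
    have "\<bar>D y\<bar> = (\<bar>(x - y) $ k\<bar> / \<sigma>\<^sup>2) * gauss \<sigma> (x - y) * \<bar>f y\<bar>"
      by (simp add: D_def abs_mult gauss_nonneg)
    also have "\<dots> \<le> ((1 + norm x) * (1 + norm y) / \<sigma>\<^sup>2) * G * \<bar>f y\<bar>"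
      unfolding G_def
      by (intro mult_mono divide_right_mono b gauss_le) (auto simp: gauss_nonneg)
    also have "\<dots> = ((1 + norm x) / \<sigma>\<^sup>2 * G) * ((1 + norm y) * \<bar>f y\<bar>)"
      by simp
    also have "\<dots> \<le> ((1 + norm x) / \<sigma>\<^sup>2 * G) * (C * decay_weight y)"
      by (intro mult_left_mono C) (auto simp: G0)
    finally show ?thesis by (simp add: mult.assoc)
  qed
  have [measurable]: "(\<lambda>y. (x - y) $ k) \<in> borel_measurable borel"
    by (intro borel_measurable_continuous_onI continuous_intros)
  have mD: "D \<in> borel_measurable borel"
    unfolding D_def[abs_def] by measurable
  have intD: "integrable lborel D"
    by (rule integrable_if_decay[OF mD]) (unfold real_norm_def, rule Dle)
  have "(\<integral>y. D y + gauss \<sigma> (x - y) * g y \<partial>lborel) = 0"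
  proof (rule integral_partial_deriv_zero[where H = "\<lambda>y. gauss \<sigma> (x - y) * f y"])
    fix y
    have "((\<lambda>t. f (y + t *\<^sub>R axis k 1)) has_real_derivative g y) (at 0)"
      unfolding g_def by (rule schwartz_has_partial_deriv[OF f])
    from DERIV_mult[OF gauss_partial_deriv[OF s] this]
    show "((\<lambda>t. gauss \<sigma> (x - (y + t *\<^sub>R axis k 1)) * f (y + t *\<^sub>R axis k 1))
        has_vector_derivative D y + gauss \<sigma> (x - y) * g y) (at 0)"
      unfolding has_real_derivative_iff_has_vector_derivative[symmetric]
      by (simp add: D_def mult_ac)
    have "norm (D y + gauss \<sigma> (x - y) * g y) \<le> \<bar>D y\<bar> + gauss \<sigma> (x - y) * \<bar>g y\<bar>"
      using abs_triangle_ineq[of "D y" "gauss \<sigma> (x - y) * g y"] by (simp add: abs_mult gauss_nonneg)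
    also have "\<dots> \<le> ((1 + norm x) / \<sigma>\<^sup>2 * G * C) * decay_weight y + G * (C' * decay_weight y)"
      unfolding G_def by (intro add_mono Dle[unfolded G_def] mult_mono gauss_le C') (auto simp: gauss_nonneg)
    finally show "norm (D y + gauss \<sigma> (x - y) * g y)
        \<le> ((1 + norm x) / \<sigma>\<^sup>2 * G * C + G * C') * decay_weight y"
      by (simp add: algebra_simps)
  next
    show "integrable lborel (\<lambda>y. gauss \<sigma> (x - y) * f y)"
      by (rule integrable_heat[OF s mf B])
  qed
  then have "heat \<sigma> g x = - (\<integral>y. D y \<partial>lborel)"
    unfolding heat_def using Bochner_Integration.integral_add[OF intD intg] by simp
  then have "\<bar>heat \<sigma> g x\<bar> \<le> (\<integral>y. \<bar>D y\<bar> \<partial>lborel)"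
    using integral_abs_bound[of lborel D] by simp
  also have "\<dots> \<le> (\<integral>y. (M / \<sigma>\<^sup>2) * (\<bar>(x - y) $ k\<bar> * gauss \<sigma> (x - y)) \<partial>lborel)"
  proof (rule integral_mono_AE)
    show "integrable lborel (\<lambda>y. \<bar>D y\<bar>)"
      using intD by simp
    show "integrable lborel (\<lambda>y. (M / \<sigma>\<^sup>2) * (\<bar>(x - y) $ k\<bar> * gauss \<sigma> (x - y)))"
      by (intro integrable_mult_right integrable_reflect[OF integrable_gauss_moment[OF s]])
    show "AE y in lborel. \<bar>D y\<bar> \<le> (M / \<sigma>\<^sup>2) * (\<bar>(x - y) $ k\<bar> * gauss \<sigma> (x - y))"
      using M
    proof eventually_elim
      case (elim y)
      have "\<bar>D y\<bar> = \<bar>f y\<bar> * (\<bar>(x - y) $ k\<bar> * gauss \<sigma> (x - y) / \<sigma>\<^sup>2)"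
        by (simp add: D_def abs_mult gauss_nonneg)
      also have "\<dots> \<le> M * (\<bar>(x - y) $ k\<bar> * gauss \<sigma> (x - y) / \<sigma>\<^sup>2)"
        by (intro mult_right_mono elim) (auto simp: gauss_nonneg)
      finally show ?case by simp
    qed
  qed
  also have "\<dots> = (\<integral>y. (M / \<sigma>\<^sup>2) * (\<bar>(y :: real ^ 'n) $ k\<bar> * gauss \<sigma> y) \<partial>lborel)"
    by (rule integral_reflect[of "\<lambda>y :: real ^ 'n. (M / \<sigma>\<^sup>2) * (\<bar>y $ k\<bar> * gauss \<sigma> y)"]) measurable
  also have "\<dots> = (M / \<sigma>\<^sup>2) * (\<integral>y. \<bar>(y :: real ^ 'n) $ k\<bar> * gauss \<sigma> y \<partial>lborel)"
    by simp
  also have "\<dots> \<le> (M / \<sigma>\<^sup>2) * \<sigma>"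
  proof (rule mult_left_mono[OF integral_gauss_moment[OF s]])
    have "AE x in (lborel :: (real ^ 'n) measure). 0 \<le> M"
      using M by eventually_elim auto
    then have "0 \<le> M"
      by (simp add: AE_lborel_const)
    then show "0 \<le> M / \<sigma>\<^sup>2" by simp
  qed
  also have "\<dots> = M / \<sigma>"
    using s by (simp add: power2_eq_square)
  finally show ?thesis unfolding g_def .
qed

section \<open>Fourier inversion\<close>

text \<open>The limit \<open>\<sigma> \<rightarrow> 0\<close> of the multiplier formula for the heat semigroup.\<close>

lemma fourier_inversion:
  fixes h :: "real ^ 'n::finite \<Rightarrow> real"
  assumes h: "schwartz h"
  shows "(\<integral>\<xi>. exp (\<i> * of_real (x \<bullet> \<xi>)) * fourier (\<lambda>y. of_real (h y)) \<xi> \<partial>lborel)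
    = of_real ((2 * pi) ^ CARD('n) * h x)"
proof -
  note [measurable] = schwartz_measurable[OF h]
  define s where "s n = inverse (real (Suc n))" for n
  define \<Phi> where "\<Phi> n \<xi> = exp (\<i> * of_real (x \<bullet> \<xi>)) * of_real (exp (- (s n)\<^sup>2 * (norm \<xi>)\<^sup>2 / 2)) *
      fourier (\<lambda>y. of_real (h y)) \<xi>" for n \<xi>
  have s: "0 < s n" for n
    by (simp add: s_def)
  have slim: "s \<longlonglongrightarrow> 0"
    unfolding s_def by (rule LIMSEQ_inverse_real_of_nat)
  have "(\<lambda>n. \<integral>\<xi>. \<Phi> n \<xi> \<partial>lborel)
      \<longlonglongrightarrow> (\<integral>\<xi>. exp (\<i> * of_real (x \<bullet> \<xi>)) * fourier (\<lambda>y. of_real (h y)) \<xi> \<partial>lborel)"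
  proof (rule integral_dominated_convergence)
    show "integrable lborel (\<lambda>\<xi>. norm (fourier (\<lambda>y. of_real (h y)) \<xi>))"
      by (intro integrable_norm integrable_fourier h)
    show "AE \<xi> in lborel. (\<lambda>n. \<Phi> n \<xi>)
        \<longlonglongrightarrow> exp (\<i> * of_real (x \<bullet> \<xi>)) * fourier (\<lambda>y. of_real (h y)) \<xi>"
    proof (rule AE_I2)
      fix \<xi> :: "real ^ 'n"
      have "(\<lambda>n. \<Phi> n \<xi>) \<longlonglongrightarrow> exp (\<i> * of_real (x \<bullet> \<xi>)) *
          of_real (exp (- 0\<^sup>2 * (norm \<xi>)\<^sup>2 / 2)) * fourier (\<lambda>y. of_real (h y)) \<xi>"
        unfolding \<Phi>_def by (intro tendsto_intros slim) auto
      then show "(\<lambda>n. \<Phi> n \<xi>) \<longlonglongrightarrow> exp (\<i> * of_real (x \<bullet> \<xi>)) * fourier (\<lambda>y. of_real (h y)) \<xi>"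
        by simp
    qed
    show "AE \<xi> in lborel. norm (\<Phi> n \<xi>) \<le> norm (fourier (\<lambda>y. of_real (h y)) \<xi>)" for n
      by (intro AE_I2) (simp add: \<Phi>_def norm_mult mult_left_le_one_le)
    show "\<Phi> n \<in> borel_measurable lborel" for n
      unfolding \<Phi>_def by measurable
  qed measurable
  moreover have "(\<lambda>n. \<integral>\<xi>. \<Phi> n \<xi> \<partial>lborel) \<longlonglongrightarrow> of_real ((2 * pi) ^ CARD('n) * h x)"
  proof -
    obtain L where L: "\<And>\<sigma>. 0 < \<sigma> \<Longrightarrow> \<bar>heat \<sigma> h x - h x\<bar> \<le> L * \<sigma>"
      using abs_heat_minus_self_le[OF h] by blast
    have "(\<lambda>n. L * s n) \<longlonglongrightarrow> 0"
      using tendsto_mult_left[OF slim, of L] by simp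
    then have "(\<lambda>n. heat (s n) h x - h x) \<longlonglongrightarrow> 0"
      by (rule Lim_null_comparison[rotated]) (auto intro!: always_eventually L s)
    then have "(\<lambda>n. heat (s n) h x) \<longlonglongrightarrow> h x"
      by (subst Lim_null)
    then have "(\<lambda>n. complex_of_real ((2 * pi) ^ CARD('n) * heat (s n) h x))
        \<longlonglongrightarrow> of_real ((2 * pi) ^ CARD('n) * h x)"
      by (intro tendsto_intros)
    then show ?thesis
      unfolding \<Phi>_def heat_fourier[OF h s] .
  qed
  ultimately show ?thesis
    by (rule LIMSEQ_unique)
qed

section \<open>Subordination of a power to Gaussians\<close>

text \<open>The integrand whose integral over \<open>\<sigma>\<close> is a multiple of \<open>r powr \<alpha>\<close>. It is defined on all of \<open>\<real>\<close>
  and vanishes for \<open>\<sigma> \<le> 0\<close>.\<close>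

definition subordination_kernel :: "real \<Rightarrow> real \<Rightarrow> real \<Rightarrow> real" where
  "subordination_kernel \<alpha> r \<sigma> = indicator {0<..} \<sigma> * (\<sigma> powr (- 1 - \<alpha>) * (1 - exp (- \<sigma>\<^sup>2 * r\<^sup>2 / 2)))"

text \<open>The factor in front of \<open>r powr \<alpha>\<close>, obtained from \<open>r = 1\<close>.\<close>

definition subordination_const :: "real \<Rightarrow> real" where
  "subordination_const \<alpha> = (\<integral>\<sigma>. subordination_kernel \<alpha> 1 \<sigma> \<partial>lborel)"

lemma subordination_kernel_nonneg: "0 \<le> subordination_kernel \<alpha> r \<sigma>"
  unfolding subordination_kernel_def by (intro mult_nonneg_nonneg) (auto simp: indicator_def)

lemma subordination_kernel_measurable [measurable]: "(\<lambda>(r, \<sigma>). subordination_kernel \<alpha> r \<sigma>) \<in> borel_measurable (borel \<Otimes>\<^sub>M borel)"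
  unfolding subordination_kernel_def by measurable

lemma has_bochner_integral_if_has_integral:
  fixes f :: "real \<Rightarrow> real"
  assumes "(f has_integral I) S" and [measurable]: "f \<in> borel_measurable borel" "S \<in> sets borel"
    and "\<And>x. x \<in> S \<Longrightarrow> 0 \<le> f x"
  shows "has_bochner_integral lborel (\<lambda>x. indicator S x * f x) I"
proof (rule has_bochner_integral_nn_integral)
  have eq: "(\<lambda>x. indicator S x * f x) = (\<lambda>x. if x \<in> S then f x else 0)"
    by (auto simp: indicator_def)
  show "(\<integral>\<^sup>+x. ennreal (indicator S x * f x) \<partial>lborel) = ennreal I"
  proof (rule nn_integral_has_integral_lborel)
    show "((\<lambda>x. indicator S x * f x) has_integral I) UNIV"
      unfolding eq using assms(1) by (simp only: has_integral_restrict_UNIV)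
  qed (use assms in \<open>auto simp: indicator_def\<close>)
  show "0 \<le> I"
    using assms by (auto intro: has_integral_nonneg)
  show "AE x in lborel. 0 \<le> indicator S x * f x"
    using assms by (auto simp: indicator_def)
qed measurable

lemma has_bochner_integral_powr_tail:
  fixes \<alpha> S :: real
  assumes "0 < \<alpha>" "0 < S"
  shows "has_bochner_integral lborel (\<lambda>\<sigma>. indicator {S..} \<sigma> * \<sigma> powr (- 1 - \<alpha>)) (S powr (- \<alpha>) / \<alpha>)"
proof (rule has_bochner_integral_if_has_integral)
  show "((\<lambda>\<sigma>. \<sigma> powr (- 1 - \<alpha>)) has_integral S powr (- \<alpha>) / \<alpha>) {S..}"
    using has_integral_powr_to_inf[of "- 1 - \<alpha>" S] assms by simp
qed auto

text \<open>Near \<open>0\<close> the kernel is at most \<open>\<sigma> powr (1 - \<alpha>)\<close>, which uses \<open>\<alpha> < 2\<close>; at infinity it is at most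
  \<open>\<sigma> powr (- 1 - \<alpha>)\<close>, which uses \<open>\<alpha> > 0\<close>.\<close>

lemma integrable_subordination_kernel_1:
  assumes a: "0 < \<alpha>" "\<alpha> < 2"
  shows "integrable lborel (subordination_kernel \<alpha> 1)"
proof (rule Bochner_Integration.integrable_bound)
  have "has_bochner_integral lborel (\<lambda>\<sigma>. indicator {0..1} \<sigma> * \<sigma> powr (1 - \<alpha>)) (1 / (2 - \<alpha>))"
  proof (rule has_bochner_integral_if_has_integral)
    show "((\<lambda>\<sigma>. \<sigma> powr (1 - \<alpha>)) has_integral 1 / (2 - \<alpha>)) {0..1}"
      using has_integral_powr_from_0[of "1 - \<alpha>" 1] a by simp
  qed auto
  then show "integrable lborel (\<lambda>\<sigma>. indicator {0..1} \<sigma> * \<sigma> powr (1 - \<alpha>) + indicator {1..} \<sigma> * \<sigma> powr (- 1 - \<alpha>))"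
    using has_bochner_integral_powr_tail[OF a(1), of 1]
    by (intro Bochner_Integration.integrable_add) (auto simp: has_bochner_integral_iff)
  show "AE \<sigma> in lborel. norm (subordination_kernel \<alpha> 1 \<sigma>)
      \<le> norm (indicator {0..1} \<sigma> * \<sigma> powr (1 - \<alpha>) + indicator {1..} \<sigma> * \<sigma> powr (- 1 - \<alpha>))"
  proof (rule AE_I2)
    fix \<sigma> :: real
    let ?R = "indicator {0..1} \<sigma> * \<sigma> powr (1 - \<alpha>) + indicator {1..} \<sigma> * \<sigma> powr (- 1 - \<alpha>)"
    consider "\<sigma> \<le> 0" | "0 < \<sigma>" "\<sigma> < 1" | "1 \<le> \<sigma>" by linarith
    then have "subordination_kernel \<alpha> 1 \<sigma> \<le> ?R"
    proof cases
      case 1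
      then show ?thesis by (simp add: subordination_kernel_def indicator_def)
    next
      case 2
      have "1 - exp (- \<sigma>\<^sup>2 / 2) \<le> \<sigma>\<^sup>2"
        using exp_ge_add_one_self[of "- \<sigma>\<^sup>2 / 2"] zero_le_power2[of \<sigma>] by linarith
      then have "\<sigma> powr (- 1 - \<alpha>) * (1 - exp (- \<sigma>\<^sup>2 / 2)) \<le> \<sigma> powr (- 1 - \<alpha>) * \<sigma>\<^sup>2"
        by (rule mult_left_mono) simp
      also have "\<sigma> powr (- 1 - \<alpha>) * \<sigma>\<^sup>2 = \<sigma> powr (- 1 - \<alpha>) * \<sigma> powr 2"
        using 2 by simp
      also have "\<dots> = \<sigma> powr (1 - \<alpha>)"
        by (simp add: powr_add[symmetric])
      finally show ?thesis
        using 2 by (simp add: subordination_kernel_def indicator_def)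
    next
      case 3
      then have "\<sigma> powr (- 1 - \<alpha>) * (1 - exp (- \<sigma>\<^sup>2 / 2)) \<le> \<sigma> powr (- 1 - \<alpha>) * 1"
        by (intro mult_left_mono) auto
      with 3 show ?thesis
        by (auto simp: subordination_kernel_def indicator_def intro: order_trans[OF _ exp_ge_zero])
    qed
    then show "norm (subordination_kernel \<alpha> 1 \<sigma>) \<le> norm ?R"
      using subordination_kernel_nonneg[of \<alpha> 1 \<sigma>] by simp
  qed
qed measurable

lemma subordination_const_pos:
  assumes a: "0 < \<alpha>" "\<alpha> < 2"
  shows "0 < subordination_const \<alpha>"
proof -
  let ?c = "1 - exp (- 1 / 2 :: real)"
  have "0 < ?c * (1 powr (- \<alpha>) / \<alpha>)"
    using a by simp
  also have "\<dots> = (\<integral>\<sigma>. ?c * (indicator {1..} \<sigma> * \<sigma> powr (- 1 - \<alpha>)) \<partial>lborel)"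
    using has_bochner_integral_powr_tail[OF a(1), of 1] by (simp add: has_bochner_integral_iff)
  also have "\<dots> \<le> subordination_const \<alpha>"
    unfolding subordination_const_def
  proof (rule integral_mono)
    show "integrable lborel (\<lambda>\<sigma>. ?c * (indicator {1..} \<sigma> * \<sigma> powr (- 1 - \<alpha>)))"
      using has_bochner_integral_powr_tail[OF a(1), of 1]
      by (intro integrable_mult_right) (simp add: has_bochner_integral_iff)
    show "integrable lborel (subordination_kernel \<alpha> 1)"
      by (rule integrable_subordination_kernel_1[OF a])
    fix \<sigma> :: real
    show "?c * (indicator {1..} \<sigma> * \<sigma> powr (- 1 - \<alpha>)) \<le> subordination_kernel \<alpha> 1 \<sigma>"
    proof (cases "1 \<le> \<sigma>")
      case True
      then have "exp (- \<sigma>\<^sup>2 / 2) \<le> exp (- 1 / 2 :: real)"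
        by simp
      then have "?c * \<sigma> powr (- 1 - \<alpha>) \<le> (1 - exp (- \<sigma>\<^sup>2 / 2)) * \<sigma> powr (- 1 - \<alpha>)"
        by (intro mult_right_mono) auto
      with True show ?thesis
        by (simp add: subordination_kernel_def indicator_def mult.commute)
    qed (use subordination_kernel_nonneg[of \<alpha> 1 \<sigma>] in \<open>simp add: indicator_def\<close>)
  qed
  finally show ?thesis .
qed

text \<open>The substitution of \<open>r * \<sigma>\<close> for \<open>\<sigma>\<close>.\<close>

lemma has_bochner_integral_subordination_kernel:
  assumes a: "0 < \<alpha>" "\<alpha> < 2" and r: "0 \<le> r"
  shows "has_bochner_integral lborel (subordination_kernel \<alpha> r) (subordination_const \<alpha> * r powr \<alpha>)"
proof (cases "r = 0")
  case True
  then have "subordination_kernel \<alpha> r = (\<lambda>_. 0)"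
    by (simp add: subordination_kernel_def fun_eq_iff)
  with True show ?thesis
    by (simp add: has_bochner_integral_zero)
next
  case False
  with r have r0: "0 < r" by simp
  have eq: "subordination_kernel \<alpha> r \<sigma> = r powr (1 + \<alpha>) * subordination_kernel \<alpha> 1 (0 + r * \<sigma>)" for \<sigma>
  proof (cases "0 < \<sigma>")
    case True
    have "r powr (1 + \<alpha>) * r powr (- 1 - \<alpha>) = 1"
      using r0 by (simp add: powr_add[symmetric])
    then have "r powr (1 + \<alpha>) * (r * \<sigma>) powr (- 1 - \<alpha>) = \<sigma> powr (- 1 - \<alpha>)"
      using r0 True by (simp add: powr_mult)
    with True r0 show ?thesis
      by (simp add: subordination_kernel_def indicator_def power_mult_distrib mult_ac)
  qed (use r0 in \<open>simp add: subordination_kernel_def indicator_def zero_less_mult_iff\<close>)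
  have int: "integrable lborel (\<lambda>\<sigma>. subordination_kernel \<alpha> 1 (0 + r * \<sigma>))"
    using r0 by (intro lborel_integrable_real_affine integrable_subordination_kernel_1 a) auto
  have "subordination_const \<alpha> = \<bar>r\<bar> *\<^sub>R (\<integral>\<sigma>. subordination_kernel \<alpha> 1 (0 + r * \<sigma>) \<partial>lborel)"
    unfolding subordination_const_def using r0 by (intro lborel_integral_real_affine) auto
  then have "(\<integral>\<sigma>. subordination_kernel \<alpha> 1 (0 + r * \<sigma>) \<partial>lborel) = subordination_const \<alpha> / r"
    using r0 by (simp add: field_simps)
  moreover have "r powr (1 + \<alpha>) = r * r powr \<alpha>"
    using r0 by (simp add: powr_add)
  ultimately show ?thesis
    using int r0 unfolding eq[abs_def] has_bochner_integral_iff by simp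
qed

section \<open>The fractional Laplacian through the heat semigroup\<close>

text \<open>The representation that replaces the singular integral. Inserting the subordination formula for
  \<open>norm \<xi> powr \<alpha>\<close> and exchanging the integrals leaves, for each \<open>\<sigma>\<close>, the difference of the inversion
  formula and the multiplier formula for the heat semigroup.\<close>

lemma frac_laplacian_heat:
  fixes h :: "real ^ 'n::finite \<Rightarrow> real"
  assumes h: "schwartz h" and a: "0 < \<alpha>" "\<alpha> < 2"
  shows "has_bochner_integral lborel
    (\<lambda>\<sigma>. indicator {0<..} \<sigma> * (\<sigma> powr (- 1 - \<alpha>) * (h x - heat \<sigma> h x)))
    (subordination_const \<alpha> * frac_laplacian \<alpha> h x)"
proof -
  note [measurable] = schwartz_measurable[OF h]
  define \<phi> where "\<phi> \<xi> = fourier (\<lambda>y. of_real (h y)) \<xi>" for \<xi>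
  define E where "E \<xi> = exp (\<i> * of_real (x \<bullet> \<xi>))" for \<xi>
  define F where "F \<xi> \<sigma> = complex_of_real (subordination_kernel \<alpha> (norm \<xi>) \<sigma>) * (E \<xi> * \<phi> \<xi>)" for \<xi> \<sigma>
  define I where "I \<sigma> = indicator {0<..} \<sigma> * (\<sigma> powr (- 1 - \<alpha>) * (h x - heat \<sigma> h x))" for \<sigma>
  have [measurable]: "\<phi> \<in> borel_measurable borel" "E \<in> borel_measurable borel"
    unfolding \<phi>_def[abs_def] E_def[abs_def] by measurable
  have nE: "norm (E \<xi>) = 1" for \<xi>
    by (simp add: E_def)
  have int\<phi>: "integrable lborel \<phi>"
    unfolding \<phi>_def[abs_def] using integrable_fourier[OF h] by simp
  have K: "has_bochner_integral lborel (\<lambda>\<sigma>. F \<xi> \<sigma>) (of_real (subordination_const \<alpha> * norm \<xi> powr \<alpha>) * (E \<xi> * \<phi> \<xi>))" for \<xi>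
    unfolding F_def
    by (intro has_bochner_integral_mult_left has_bochner_integral_of_real
        has_bochner_integral_subordination_kernel a) simp
  have nF: "norm (F \<xi> \<sigma>) = subordination_kernel \<alpha> (norm \<xi>) \<sigma> * norm (\<phi> \<xi>)" for \<xi> \<sigma>
    by (simp add: F_def norm_mult nE subordination_kernel_nonneg)
  have int: "integrable (lborel \<Otimes>\<^sub>M lborel) (\<lambda>(\<xi>, \<sigma>). F \<xi> \<sigma>)"
  proof (rule lborel_pair.Fubini_integrable)
    have "(\<lambda>(\<xi>, \<sigma>). complex_of_real (subordination_kernel \<alpha> (norm \<xi>) \<sigma>) * (E \<xi> * \<phi> \<xi>)) \<in> borel_measurable (borel \<Otimes>\<^sub>M borel)"
      by measurable
    then show "(\<lambda>(\<xi>, \<sigma>). F \<xi> \<sigma>) \<in> borel_measurable (lborel \<Otimes>\<^sub>M lborel)"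
      unfolding F_def by simp
    have "(\<integral>\<sigma>. norm (F \<xi> \<sigma>) \<partial>lborel) = subordination_const \<alpha> * norm (of_real (norm \<xi> powr \<alpha>) * \<phi> \<xi>)" for \<xi>
      unfolding nF using has_bochner_integral_subordination_kernel[OF a norm_ge_zero[of \<xi>]]
      by (simp add: has_bochner_integral_iff norm_mult)
    moreover have "integrable lborel (\<lambda>\<xi>. subordination_const \<alpha> * norm (of_real (norm \<xi> powr \<alpha>) * \<phi> \<xi>))"
      unfolding \<phi>_def using a
      by (intro integrable_mult_right integrable_norm integrable_fourier_powr h) auto
    ultimately show "integrable lborel (\<lambda>\<xi>. \<integral>\<sigma>. norm (case (\<xi>, \<sigma>) of (\<xi>, \<sigma>) \<Rightarrow> F \<xi> \<sigma>) \<partial>lborel)"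
      by simp
    show "AE \<xi> in lborel. integrable lborel (\<lambda>\<sigma>. case (\<xi>, \<sigma>) of (\<xi>, \<sigma>) \<Rightarrow> F \<xi> \<sigma>)"
      using K by (auto simp: has_bochner_integral_iff)
  qed
  have inner: "(\<integral>\<xi>. F \<xi> \<sigma> \<partial>lborel) = of_real ((2 * pi) ^ CARD('n) * I \<sigma>)" for \<sigma>
  proof (cases "0 < \<sigma>")
    case True
    let ?g = "\<lambda>\<xi>. complex_of_real (exp (- \<sigma>\<^sup>2 * (norm \<xi>)\<^sup>2 / 2))"
    have i1: "integrable lborel (\<lambda>\<xi>. E \<xi> * \<phi> \<xi>)"
      by (rule Bochner_Integration.integrable_bound[OF int\<phi>]) (auto simp: norm_mult nE)
    have i2: "integrable lborel (\<lambda>\<xi>. E \<xi> * ?g \<xi> * \<phi> \<xi>)"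
      by (rule Bochner_Integration.integrable_bound[OF int\<phi>])
         (auto simp: norm_mult nE mult_left_le_one_le)
    have "F \<xi> \<sigma> = of_real (\<sigma> powr (- 1 - \<alpha>)) * (E \<xi> * \<phi> \<xi> - E \<xi> * ?g \<xi> * \<phi> \<xi>)" for \<xi>
      using True by (simp add: F_def subordination_kernel_def algebra_simps)
    then have "(\<integral>\<xi>. F \<xi> \<sigma> \<partial>lborel) = of_real (\<sigma> powr (- 1 - \<alpha>)) *
        ((\<integral>\<xi>. E \<xi> * \<phi> \<xi> \<partial>lborel) - (\<integral>\<xi>. E \<xi> * ?g \<xi> * \<phi> \<xi> \<partial>lborel))"
      by (simp only: integral_mult_right_zero Bochner_Integration.integral_diff[OF i1 i2])
    also have "\<dots> = of_real (\<sigma> powr (- 1 - \<alpha>)) *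
        (of_real ((2 * pi) ^ CARD('n) * h x) - of_real ((2 * pi) ^ CARD('n) * heat \<sigma> h x))"
      unfolding E_def \<phi>_def fourier_inversion[OF h] heat_fourier[OF h True] ..
    also have "\<dots> = of_real ((2 * pi) ^ CARD('n) * I \<sigma>)"
      using True by (simp add: I_def algebra_simps)
    finally show ?thesis .
  next
    case False
    then show ?thesis by (simp add: F_def subordination_kernel_def I_def)
  qed
  have "complex_of_real (subordination_const \<alpha> * frac_laplacian \<alpha> h x)
      = of_real (subordination_const \<alpha>) * frac_laplacian_complex \<alpha> (\<lambda>y. of_real (h y)) x"
    by (simp add: of_real_frac_laplacian)
  also have "\<dots> = of_real (1 / (2 * pi) ^ CARD('n)) *
      (of_real (subordination_const \<alpha>) * (\<integral>\<xi>. E \<xi> * (of_real (norm \<xi> powr \<alpha>) * \<phi> \<xi>) \<partial>lborel))"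
    by (simp only: frac_laplacian_complex_def inverse_fourier_def E_def \<phi>_def mult_ac)
  also have "of_real (subordination_const \<alpha>) * (\<integral>\<xi>. E \<xi> * (of_real (norm \<xi> powr \<alpha>) * \<phi> \<xi>) \<partial>lborel)
      = (\<integral>\<xi>. of_real (subordination_const \<alpha> * norm \<xi> powr \<alpha>) * (E \<xi> * \<phi> \<xi>) \<partial>lborel)"
    by (simp only: integral_mult_right_zero[symmetric] of_real_mult mult_ac)
  also have "\<dots> = (\<integral>\<xi>. (\<integral>\<sigma>. F \<xi> \<sigma> \<partial>lborel) \<partial>lborel)"
    using K by (simp add: has_bochner_integral_iff)
  also have "\<dots> = (\<integral>\<sigma>. (\<integral>\<xi>. F \<xi> \<sigma> \<partial>lborel) \<partial>lborel)"
    by (rule lborel_pair.Fubini_integral[OF int, symmetric])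
  also have "\<dots> = (\<integral>\<sigma>. of_real ((2 * pi) ^ CARD('n) * I \<sigma>) \<partial>lborel)"
    unfolding inner ..
  also have "\<dots> = of_real ((2 * pi) ^ CARD('n) * (\<integral>\<sigma>. I \<sigma> \<partial>lborel))"
    by (subst integral_complex_of_real) simp
  finally have "complex_of_real (subordination_const \<alpha> * frac_laplacian \<alpha> h x)
      = of_real (1 / (2 * pi) ^ CARD('n) * ((2 * pi) ^ CARD('n) * (\<integral>\<sigma>. I \<sigma> \<partial>lborel)))"
    by (simp only: of_real_mult)
  then have val: "subordination_const \<alpha> * frac_laplacian \<alpha> h x = (\<integral>\<sigma>. I \<sigma> \<partial>lborel)"
    by (subst (asm) of_real_eq_iff) simp
  \<comment> \<open>Integrability of the right-hand side is a by-product of Fubini.\<close>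
  have "integrable lborel (\<lambda>\<sigma>. \<integral>\<xi>. F \<xi> \<sigma> \<partial>lborel)"
    by (rule lborel_pair.integrable_snd[OF int])
  then have "integrable lborel (\<lambda>\<sigma>. (2 * pi) ^ CARD('n) * I \<sigma>)"
    unfolding inner by (simp only: complex_of_real_integrable_eq)
  then have "integrable lborel I"
    by simp
  then show ?thesis
    unfolding has_bochner_integral_iff I_def[symmetric] using val by simp
qed

section \<open>The lower bound at a maximum\<close>

text \<open>Boundedness makes the essential supremum finite, so that the conversion to \<open>real\<close> loses nothing.\<close>

lemma AE_le_Linfty_norm:
  fixes f :: "real ^ 'n::finite \<Rightarrow> real"
  assumes [measurable]: "f \<in> borel_measurable borel" and B: "\<And>x. \<bar>f x\<bar> \<le> B"
  shows "AE x in lborel. \<bar>f x\<bar> \<le> Linfty_norm f"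
proof -
  let ?s = "esssup lborel (\<lambda>x. ereal \<bar>f x\<bar>)"
  have le: "?s \<le> ereal B"
    by (intro esssup_I) (auto simp: B)
  have AE: "AE x in lborel. ereal \<bar>f x\<bar> \<le> ?s"
    by (rule esssup_AE)
  have "AE x in (lborel :: (real ^ 'n) measure). 0 \<le> ?s"
    using AE by eventually_elim (meson abs_ge_zero ereal_less_eq(5) order_trans)
  then have "0 \<le> ?s"
    by (simp add: AE_lborel_const)
  with le have "ereal (real_of_ereal ?s) = ?s"
    by (intro ereal_real') auto
  then show ?thesis
    using AE unfolding Linfty_norm_def by (metis (mono_tags, lifting) AE_cong ereal_less_eq(3))
qed

theorem theorem2p1:
  fixes \<alpha> :: real
  assumes "0 < \<alpha>" and "\<alpha> < 2"
  shows "\<exists>c>0. \<forall>(f :: real ^ 'n::finite \<Rightarrow> real) (k :: 'n) (xbar :: real ^ 'n).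
           schwartz f \<longrightarrow>
           (\<forall>x. partial_deriv k f x \<le> partial_deriv k f xbar) \<longrightarrow>
           partial_deriv k f xbar > 0 \<longrightarrow>
           frac_laplacian \<alpha> (partial_deriv k f) xbar
             \<ge> partial_deriv k f xbar powr (1 + \<alpha>) / (c * Linfty_norm f powr \<alpha>)"
proof (intro exI[of _ "2 * \<alpha> * subordination_const \<alpha> * 2 powr \<alpha>"] conjI allI impI)
  note K = subordination_const_pos[OF assms]
  show "0 < 2 * \<alpha> * subordination_const \<alpha> * 2 powr \<alpha>"
    using K assms by simp
  fix f :: "real ^ 'n::finite \<Rightarrow> real" and k :: 'n and xbar :: "real ^ 'n"
  assume f: "schwartz f" and le: "\<forall>x. partial_deriv k f x \<le> partial_deriv k f xbar"
    and pos: "partial_deriv k f xbar > 0"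
  define g where "g = partial_deriv k f"
  define m where "m = g xbar"
  define M where "M = Linfty_norm f"
  define I where "I \<sigma> = indicator {0<..} \<sigma> * (\<sigma> powr (- 1 - \<alpha>) * (m - heat \<sigma> g xbar))" for \<sigma>
  have g: "schwartz g"
    unfolding g_def by (rule schwartz_partial_deriv[OF f])
  obtain B where B: "\<And>x. \<bar>f x\<bar> \<le> B"
    using schwartz_bounded[OF f] by blast
  obtain B' where B': "\<And>x. \<bar>g x\<bar> \<le> B'"
    using schwartz_bounded[OF g] by blast
  have m: "0 < m" and gm: "\<And>x. g x \<le> m"
    using le pos by (auto simp: g_def m_def)
  have AEM: "AE x in lborel. \<bar>f x\<bar> \<le> M"
    unfolding M_def by (rule AE_le_Linfty_norm[OF schwartz_measurable[OF f] B])
  then have "AE x in (lborel :: (real ^ 'n) measure). 0 \<le> M"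
    by eventually_elim auto
  then have M0: "0 \<le> M"
    by (simp add: AE_lborel_const)
  have I: "integrable lborel I" "subordination_const \<alpha> * frac_laplacian \<alpha> g xbar = (\<integral>\<sigma>. I \<sigma> \<partial>lborel)"
    using frac_laplacian_heat[OF g assms, of xbar]
    unfolding has_bochner_integral_iff I_def[abs_def] m_def by auto
  have I_nonneg: "0 \<le> I \<sigma>" for \<sigma>
    using heat_le[OF _ schwartz_measurable[OF g] B' gm, of \<sigma> xbar]
    unfolding I_def by (auto simp: indicator_def)
  have "m powr (1 + \<alpha>) / (2 * \<alpha> * subordination_const \<alpha> * 2 powr \<alpha> * M powr \<alpha>) \<le> frac_laplacian \<alpha> g xbar"
  proof (cases "M = 0")
    case True
    \<comment> \<open>Here the left-hand side is \<open>0\<close> by the convention for division by zero, and nonnegativity of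
      the integrand suffices.\<close>
    have "0 \<le> subordination_const \<alpha> * frac_laplacian \<alpha> g xbar"
      unfolding I(2) by (intro integral_nonneg_AE AE_I2 I_nonneg)
    with True K show ?thesis
      by (simp add: zero_le_mult_iff)
  next
    case False
    with M0 have M: "0 < M" by simp
    \<comment> \<open>From this threshold on, \<open>heat \<sigma> g xbar\<close> is at most half of the maximum.\<close>
    define S where "S = 2 * M / m"
    have S: "0 < S"
      unfolding S_def using M m by simp
    note tail = has_bochner_integral_powr_tail[OF assms(1) S]
    have "(m / 2) * (S powr (- \<alpha>) / \<alpha>) = (\<integral>\<sigma>. (m / 2) * (indicator {S..} \<sigma> * \<sigma> powr (- 1 - \<alpha>)) \<partial>lborel)"
      using tail by (simp add: has_bochner_integral_iff)
    also have "\<dots> \<le> (\<integral>\<sigma>. I \<sigma> \<partial>lborel)"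
    proof (rule integral_mono)
      show "integrable lborel (\<lambda>\<sigma>. (m / 2) * (indicator {S..} \<sigma> * \<sigma> powr (- 1 - \<alpha>)))"
        using tail by (intro integrable_mult_right) (simp add: has_bochner_integral_iff)
      fix \<sigma> :: real
      show "(m / 2) * (indicator {S..} \<sigma> * \<sigma> powr (- 1 - \<alpha>)) \<le> I \<sigma>"
      proof (cases "S \<le> \<sigma>")
        case True
        with S have \<sigma>: "0 < \<sigma>" by simp
        have "M / \<sigma> \<le> M / S"
          using True S M by (intro divide_left_mono) auto
        also have "\<dots> = m / 2"
          using M m by (simp add: S_def)
        finally have "heat \<sigma> g xbar \<le> m / 2"
          using heat_partial_deriv_le[OF f \<sigma> AEM, of k xbar] unfolding g_def by linarith
        then have "(m / 2) * \<sigma> powr (- 1 - \<alpha>) \<le> (m - heat \<sigma> g xbar) * \<sigma> powr (- 1 - \<alpha>)"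
          by (intro mult_right_mono) auto
        with True \<sigma> show ?thesis
          by (simp add: I_def mult.commute)
      qed (use I_nonneg in simp)
    qed (rule I)
    finally have main: "(m / 2) * (S powr (- \<alpha>) / \<alpha>) \<le> subordination_const \<alpha> * frac_laplacian \<alpha> g xbar"
      using I by simp
    have "S powr (- \<alpha>) = m powr \<alpha> / (2 powr \<alpha> * M powr \<alpha>)"
      using M m by (simp add: S_def powr_minus powr_divide powr_mult)
    moreover have "m powr (1 + \<alpha>) = m * m powr \<alpha>"
      using m by (simp add: powr_add)
    ultimately have "m powr (1 + \<alpha>) / (2 * \<alpha> * subordination_const \<alpha> * 2 powr \<alpha> * M powr \<alpha>)
        = (m / 2) * (S powr (- \<alpha>) / \<alpha>) / subordination_const \<alpha>"
      by simp
    also have "\<dots> \<le> frac_laplacian \<alpha> g xbar"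
      using main by (simp only: pos_divide_le_eq[OF K] mult.commute[of _ "subordination_const \<alpha>"])
    finally show ?thesis .
  qed
  then show "partial_deriv k f xbar powr (1 + \<alpha>) / (2 * \<alpha> * subordination_const \<alpha> * 2 powr \<alpha> * Linfty_norm f powr \<alpha>)
      \<le> frac_laplacian \<alpha> (partial_deriv k f) xbar"
    unfolding g_def m_def M_def .
qed

end
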